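(* Let $\Gamma$ be a family of finite cycles on the lattice $\mathbb Z^2$ (with nearest-neighbor arcs) and $\{Z_\gamma:\gamma\in\Gamma\}$ nonnegative random variables such that $\sum_{\gamma\in\Gamma}Z_\gamma|\chi_\gamma(x,y)|<\infty$ for each arc $(x,y)$ and $\sum_{\gamma\in\Gamma}\mathbf E[Z_\gamma]\,|W_{\gamma,\gamma_x}|<\infty$ for all $x\in\mathbb Z^2$. Let $c_a=\sum_{\gamma\in\Gamma}Z_\gamma\chi_\gamma=\sum_{x\in\mathbb Z^2}W_{\gamma_x}\chi_{\gamma_x}$, where $W_{\gamma_x}=\sum_{\gamma\in\Gamma}Z_\gamma W_{\gamma,\gamma_x}$. Let $\{Y_{(x,y)}\}$ be nonnegative random variables indexed by the arcs with $Y_{(x,y)}=Y_{(y,x)}$, and let the symmetric conductances be either $c_s(x,y)=Y_{(x,y)}+|c_a(x,y)|$ for all arcs, or $c_s(x,y)=Y_{(x,y)}+\sum_{\gamma\in\Gamma}Z_\gamma|\chi_\gamma(x,y)|$ for all arcs. Assume that $c_s(x,y)>0$ for all arcs and that the random walk on $\mathbb Z^2$ with asymmetric conductances $c(x,y)=c_s(x,y)+c_a(x,y)$ is almost surely irreducible. Suppose that $$\sup_{(x,y)}\mathbf E\Big[c_s(x,y)+\frac{[W_{\gamma^+(x,y)}]^2+[W_{\gamma^-(x,y)}]^2}{c_s(x,y)}\Big]<\infty,$$ where the supremum is over all arcs. Then the random walk is almost surely recurrent.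
   Context: Arcs are ordered pairs $(x,y)$ of nearest neighbors in $\mathbb Z^2$. A cycle is a finite sequence $\gamma=(x_0,\dots,x_n=x_0)$ with each $(x_i,x_{i+1})$ an arc and $x_i\ne x_j$ for $0\le i<j<n$. Its flow is $\chi_\gamma=\sum_{i=0}^{n-1}\{\delta_{(x_i,x_{i+1})}-\delta_{(x_{i+1},x_i)}\}$, a function on arcs. For $x\in\mathbb Z^2$, $\gamma_x$ is the elementary cycle $(x,x+e_1,x+e_1+e_2,x+e_2,x)$, where $e_1,e_2$ is the canonical basis. For a finite cycle $\gamma$, $W_{\gamma,\gamma_x}=1$ (resp. $-1$) if the cycle $\gamma_x$ is contained in the interior of $\gamma$ (i.e. the unit square bounded by $\gamma_x$ lies in the region enclosed by $\gamma$) and $\gamma$ runs counter-clockwise (resp. clockwise), and $W_{\gamma,\gamma_x}=0$ if $\gamma_x$ is not contained in the interior of $\gamma$; one has $\chi_\gamma=\sum_x W_{\gamma,\gamma_x}\chi_{\gamma_x}$. Each arc $(x,y)$ belongs (up to orientation) to exactly two elementary cycles $\gamma^{\pm}(x,y)$, characterized by $\chi_{\gamma^\pm(x,y)}(x,y)=\pm1$; thus $c_a(x,y)=W_{\gamma^+(x,y)}-W_{\gamma^-(x,y)}$. $\mathbf E$ is expectation over the random environment (the variables $Z_\gamma$, $Y_{(x,y)}$). Given the environment, the random walk with conductances $c(x,y)\ge0$ jumps from $x$ to $y$ with probability $c(x,y)/\sum_{z}c(x,z)$; $M(x)=\sum_z c(x,z)$ is a stationary measure since $c_a$ is antisymmetric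 and divergence free. "Almost surely recurrent" means recurrent for almost every environment. *)

theory Defs
  imports "HOL-Probability.Probability" "HOL-Complex_Analysis.Complex_Analysis"
begin

type_synonym pt = "int \<times> int"
type_synonym arc = "pt \<times> pt"

definition arcs :: "arc set" where
  "arcs = {(x, y). \<bar>fst x - fst y\<bar> + \<bar>snd x - snd y\<bar> = 1}"

text \<open>A cycle is represented by the full vertex sequence, the repeated endpoint included.
  Back-and-forth cycles of length two are cycles; a one-point sequence is the degenerate
  case of length zero, with zero flow and empty interior.\<close>

definition is_cycle :: "pt list \<Rightarrow> bool" where
  "is_cycle \<gamma> \<longleftrightarrow> \<gamma> \<noteq> [] \<and> last \<gamma> = hd \<gamma> \<and> distinct (butlast \<gamma>) \<and>
     (\<forall>i < length \<gamma> - 1. (\<gamma> ! i, \<gamma> ! Suc i) \<in> arcs)"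

definition flow :: "pt list \<Rightarrow> arc \<Rightarrow> real" where
  "flow \<gamma> a = (\<Sum>i < length \<gamma> - 1.
     of_bool (a = (\<gamma> ! i, \<gamma> ! Suc i)) - of_bool (a = (\<gamma> ! Suc i, \<gamma> ! i)))"

definition elem_cycle :: "pt \<Rightarrow> pt list" where
  "elem_cycle x = [x, x + (1, 0), x + (1, 1), x + (0, 1), x]"

definition emb :: "pt \<Rightarrow> complex" where
  "emb x = Complex (of_int (fst x)) (of_int (snd x))"

text \<open>The two-point clause comes before the general one so that the path of a cycle
  has no constant final piece, which would destroy simplicity of the path.\<close>

fun poly_path :: "complex list \<Rightarrow> real \<Rightarrow> complex" where
  "poly_path [] = linepath 0 0"
| "poly_path [u] = linepath u u"
| "poly_path [u, v] = linepath u v"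
| "poly_path (u # v # w # zs) = linepath u v +++ poly_path (v # w # zs)"

definition curve :: "pt list \<Rightarrow> real \<Rightarrow> complex" where
  "curve \<gamma> = poly_path (map emb \<gamma>)"

definition region :: "pt list \<Rightarrow> complex set" where
  "region \<gamma> = inside (path_image (curve \<gamma>))"

definition unit_square :: "pt \<Rightarrow> complex set" where
  "unit_square x = box (emb x) (emb (x + (1, 1)))"

definition runs_ccw :: "pt list \<Rightarrow> bool" where
  "runs_ccw \<gamma> \<longleftrightarrow> (\<forall>z \<in> region \<gamma>. winding_number (curve \<gamma>) z = 1)"

definition runs_cw :: "pt list \<Rightarrow> bool" where
  "runs_cw \<gamma> \<longleftrightarrow> (\<forall>z \<in> region \<gamma>. winding_number (curve \<gamma>) z = - 1)"

text \<open>\<open>face_weight \<gamma> x\<close> is the orientation-signed indicator, usually written \<open>W\<close>, that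
  the unit square at \<open>x\<close> is enclosed by \<open>\<gamma>\<close>.  The open square
  is used because \<open>region \<gamma>\<close> does not contain the edges of \<open>\<gamma>\<close> itself.\<close>

definition face_weight :: "pt list \<Rightarrow> pt \<Rightarrow> real" where
  "face_weight \<gamma> x =
     (if unit_square x \<subseteq> region \<gamma>
      then (if runs_ccw \<gamma> then 1 else if runs_cw \<gamma> then - 1 else 0) else 0)"

text \<open>Base points of the two elementary cycles to which an arc belongs; the base point is unique for
  \<open>a \<in> arcs\<close> and unspecified otherwise.\<close>

definition face_pos :: "arc \<Rightarrow> pt" where
  "face_pos a = (THE x. flow (elem_cycle x) a = 1)"

definition face_neg :: "arc \<Rightarrow> pt" where
  "face_neg a = (THE x. flow (elem_cycle x) a = - 1)"

definition cond_asym :: "pt list set \<Rightarrow> (pt list \<Rightarrow> 'w \<Rightarrow> real) \<Rightarrow> arc \<Rightarrow> 'w \<Rightarrow> real" where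
  "cond_asym \<Gamma> Z a \<omega> = (\<Sum>\<^sub>\<infinity>\<gamma>\<in>\<Gamma>. Z \<gamma> \<omega> * flow \<gamma> a)"

definition cond_abs :: "pt list set \<Rightarrow> (pt list \<Rightarrow> 'w \<Rightarrow> real) \<Rightarrow> arc \<Rightarrow> 'w \<Rightarrow> real" where
  "cond_abs \<Gamma> Z a \<omega> = (\<Sum>\<^sub>\<infinity>\<gamma>\<in>\<Gamma>. Z \<gamma> \<omega> * \<bar>flow \<gamma> a\<bar>)"

definition face_total :: "pt list set \<Rightarrow> (pt list \<Rightarrow> 'w \<Rightarrow> real) \<Rightarrow> pt \<Rightarrow> 'w \<Rightarrow> real" where
  "face_total \<Gamma> Z x \<omega> = (\<Sum>\<^sub>\<infinity>\<gamma>\<in>\<Gamma>. Z \<gamma> \<omega> * face_weight \<gamma> x)"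

definition jump :: "(arc \<Rightarrow> real) \<Rightarrow> pt \<Rightarrow> pt \<Rightarrow> real" where
  "jump c x y = (if (x, y) \<in> arcs then c (x, y) / (\<Sum>z | (x, z) \<in> arcs. c (x, z)) else 0)"

fun nstep :: "(arc \<Rightarrow> real) \<Rightarrow> nat \<Rightarrow> pt \<Rightarrow> pt \<Rightarrow> real" where
  "nstep c 0 x y = of_bool (x = y)"
| "nstep c (Suc n) x y = (\<Sum>z | (x, z) \<in> arcs. jump c x z * nstep c n z y)"

definition irreducible_walk :: "(arc \<Rightarrow> real) \<Rightarrow> bool" where
  "irreducible_walk c \<longleftrightarrow> (\<forall>x y. \<exists>n. nstep c n x y > 0)"

text \<open>\<open>walk_law c x N\<close>: \<open>N\<close> is the law, on trajectories, of the walk with conductances \<open>c\<close>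
  started at \<open>x\<close>.  It is determined by its finite-dimensional distributions, so there is at
  most one such \<open>N\<close>; there is one whenever \<open>jump c\<close> is a stochastic matrix.\<close>

definition walk_law :: "(arc \<Rightarrow> real) \<Rightarrow> pt \<Rightarrow> (nat \<Rightarrow> pt) measure \<Rightarrow> bool" where
  "walk_law c x N \<longleftrightarrow> prob_space N \<and> sets N = sets (Pi\<^sub>M UNIV (\<lambda>_. count_space UNIV)) \<and>
     (\<forall>n \<xi>. measure N {X \<in> space N. \<forall>i\<le>n. X i = \<xi> i} =
        of_bool (\<xi> 0 = x) * (\<Prod>i<n. jump c (\<xi> i) (\<xi> (Suc i))))"

definition recurrent_walk :: "(arc \<Rightarrow> real) \<Rightarrow> bool" where
  "recurrent_walk c \<longleftrightarrow> (\<forall>x. \<exists>N. walk_law c x N \<and> (AE X in N. \<exists>n>0. X n = x))"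

end

(*
  Let h be the probability of hitting x0 before leaving a box, for the walk in a fixed environment.
  Since c_a is divergence free, the c_s-Dirichlet energy of h is -(L h)(x0), which bounds the escape
  probability from above, and -(L h)(x0) is also -<F, L h> for every F supported in the box with
  F(x0) = 1.  Because c_a is the curl of the face function W, the antisymmetric part of <F, L h> can
  be regrouped face by face so that it only sees differences of F and of h; Cauchy-Schwarz then
  bounds the energy of h by a sum of |grad F|^2 (c_s + W^2 / c_s).  For the logarithmic cutoff F of
  the planar lattice the expectation of this sum tends to 0, so along a random sequence of boxes it
  tends to 0 almost surely.  That c_a is the curl of W is the statement that the winding number of a
  lattice cycle jumps by its flow across an edge.
*)

theory Submission
  imports Defs "HOL-Real_Asymp.Real_Asymp"
begin

section \<open>Faces and winding numbers of lattice cycles\<close>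

text \<open>The obstacle is the asymmetric part of the mixed pairing: edge by edge it multiplies an
  increment of \<open>h\<close> by values of the cutoff, not by its increments, and these values are
  not small. A second summation by parts repairs this, and its price is the face function: this is
  where the square of W over \<open>c_s\<close> in the moment condition comes from. The expected
  cost is of the order of the inverse logarithm of the radius; convergence to zero without a rate
  suffices, since already the infimum over all radii then has expectation zero. The weights W are
  defined by enclosure, which is global, whereas the curl identity is local. The Jordan curve
  theorem turns enclosure into a winding number, and the winding numbers around two adjacent faces
  are compared through a logarithm whose branch cut is the segment joining their centres.\<close>

lemma arcs_iff:
  "(x, y) \<in> arcs \<longleftrightarrow> y = x + (1, 0) \<or> y = x + (0, 1) \<or> x = y + (1, 0) \<or> x = y + (0, 1)"
  by (cases x; cases y) (auto simp: arcs_def)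

lemma arcs_sym: "(x, y) \<in> arcs \<longleftrightarrow> (y, x) \<in> arcs"
  by (auto simp: arcs_iff)

lemma arcs_neq: "(x, y) \<in> arcs \<Longrightarrow> x \<noteq> y"
  by (auto simp: arcs_def)

lemma Re_emb [simp]: "Re (emb x) = of_int (fst x)" and Im_emb [simp]: "Im (emb x) = of_int (snd x)"
  by (simp_all add: emb_def)

lemma emb_eq_iff [simp]: "emb x = emb y \<longleftrightarrow> x = y"
  by (auto simp: complex_eq_iff prod_eq_iff)

text \<open>A single sample point per face suffices for winding numbers: the open square is
  connected and no lattice edge enters it.\<close>

definition centre :: "pt \<Rightarrow> complex" where
  "centre x = emb x + Complex (1/2) (1/2)"

text \<open>The elementary cycles run counter-clockwise, so the positive face of an arc is the
  square on its left and the negative face the square on its right.\<close>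

lemma face_pos_right: "face_pos (x, x + (1, 0)) = x"
  and face_neg_right: "face_neg (x, x + (1, 0)) = x - (0, 1)"
  and face_pos_up: "face_pos (x, x + (0, 1)) = x - (1, 0)"
  and face_neg_up: "face_neg (x, x + (0, 1)) = x"
  and face_pos_left: "face_pos (x + (1, 0), x) = x - (0, 1)"
  and face_neg_left: "face_neg (x + (1, 0), x) = x"
  and face_pos_down: "face_pos (x + (0, 1), x) = x"
  and face_neg_down: "face_neg (x + (0, 1), x) = x - (1, 0)"
  unfolding face_pos_def face_neg_def
  by (rule the_equality;
      cases x; force simp: flow_def elem_cycle_def lessThan_Suc numeral_eq_Suc of_bool_def prod_eq_iff
        split: if_splits)+

lemma edge_coords:
  assumes "(p, q) \<in> arcs" "z \<in> closed_segment (emb p) (emb q)"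
  shows "(fst p = fst q \<and> \<bar>snd p - snd q\<bar> = 1 \<and> Re z = of_int (fst p) \<and>
            of_int (min (snd p) (snd q)) \<le> Im z \<and> Im z \<le> of_int (max (snd p) (snd q))) \<or>
         (snd p = snd q \<and> \<bar>fst p - fst q\<bar> = 1 \<and> Im z = of_int (snd p) \<and>
            of_int (min (fst p) (fst q)) \<le> Re z \<and> Re z \<le> of_int (max (fst p) (fst q)))"
proof -
  have "fst p = fst q \<and> \<bar>snd p - snd q\<bar> = 1 \<or> snd p = snd q \<and> \<bar>fst p - fst q\<bar> = 1"
    using assms(1) by (auto simp: arcs_def)
  moreover have "z \<in> closed_segment (of_int m) (of_int n) \<longleftrightarrow>
      of_int (min m n) \<le> z \<and> z \<le> of_int (max m n)" for z :: real and m n :: int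
    by (simp add: closed_segment_eq_real_ivl min_def max_def)
  ultimately show ?thesis
    using assms(2) closed_segment_same_Re[of "emb p" "emb q"] closed_segment_same_Im[of "emb p" "emb q"]
    by (elim disjE conjE; simp)
qed

text \<open>Distinct unit intervals with integer ends on one line share at most an end, and parallel
  edges on different lines are disjoint. A horizontal and a vertical edge can meet only where both
  coordinates are integers, and the only integers in such a unit interval are its ends.\<close>

lemma edges_meet_at_vertices:
  assumes "(p, q) \<in> arcs" "(r, s) \<in> arcs" "{p, q} \<noteq> {r, s}"
    and "z \<in> closed_segment (emb p) (emb q)" "z \<in> closed_segment (emb r) (emb s)"
  shows "\<exists>w \<in> {p, q} \<inter> {r, s}. z = emb w"
proof -
  \<comment> \<open>One-sided form; used a second time with the edges exchanged, it makes the point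
    a vertex of both edges.\<close>
  have *: "z = emb p \<or> z = emb q"
    if a: "(p, q) \<in> arcs" "(r, s) \<in> arcs" "{p, q} \<noteq> {r, s}"
      "z \<in> closed_segment (emb p) (emb q)" "z \<in> closed_segment (emb r) (emb s)" for p q r s
  proof -
    obtain a b where p: "p = (a, b)" by fastforce
    obtain a' b' where q: "q = (a', b')" by fastforce
    obtain c d where r: "r = (c, d)" by fastforce
    obtain c' d' where s: "s = (c', d')" by fastforce
    have mm: "{m, n} = {min m n, max m n}" for m n :: int
      by (auto simp: min_def max_def)
    let ?V = "\<lambda>a b a' b'. a = a' \<and> \<bar>b - b'\<bar> = 1 \<and> Re z = of_int a \<and>
      of_int (min b b') \<le> Im z \<and> Im z \<le> of_int (max b b')"
    let ?H = "\<lambda>a b a' b'. b = b' \<and> \<bar>a - a'\<bar> = 1 \<and> Im z = of_int b \<and>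
      of_int (min a a') \<le> Re z \<and> Re z \<le> of_int (max a a')"
    have "?V a b a' b' \<or> ?H a b a' b'" "?V c d c' d' \<or> ?H c d c' d'"
      using edge_coords[OF a(1,4)] edge_coords[OF a(2,5)] unfolding p q r s fst_conv snd_conv
      by blast+
    then consider (vv) "?V a b a' b'" "?V c d c' d'" | (hh) "?H a b a' b'" "?H c d c' d'"
      | (vh) "?V a b a' b'" "?H c d c' d'" | (hv) "?H a b a' b'" "?V c d c' d'"
      by blast
    then show ?thesis
    proof cases
      case vv
      have "max b b' = min b b' + 1" "max d d' = min d d' + 1"
        using vv(1)[THEN conjunct2, THEN conjunct1] vv(2)[THEN conjunct2, THEN conjunct1] by linarith+
      moreover have "min b b' \<noteq> min d d'"
      proof
        assume "min b b' = min d d'"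
        with calculation have "{b, b'} = {d, d'}" by (metis mm)
        moreover have "a' = a" "c = a" "c' = a" using vv by (metis of_int_eq_iff)+
        ultimately have "{p, q} = {r, s}"
          unfolding p q r s by (auto simp: doubleton_eq_iff)
        then show False using a(3) by blast
      qed
      ultimately have "max b b' \<le> min d d' \<or> max d d' \<le> min b b'" by linarith
      then have "of_int (max b b') \<le> (of_int (min d d') :: real) \<or>
          of_int (max d d') \<le> (of_int (min b b') :: real)"
        unfolding of_int_le_iff .
      with vv have "Im z = of_int (max b b') \<or> Im z = of_int (min b b')"
        by (meson order_antisym order_trans)
      then have "Im z = of_int b \<or> Im z = of_int b'"
        by (metis max_def min_def)
      then show ?thesis using vv(1) by (metis complex_eq_iff Re_emb Im_emb fst_conv snd_conv p q)
    next
      case hh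
      have "max a a' = min a a' + 1" "max c c' = min c c' + 1"
        using hh(1)[THEN conjunct2, THEN conjunct1] hh(2)[THEN conjunct2, THEN conjunct1] by linarith+
      moreover have "min a a' \<noteq> min c c'"
      proof
        assume "min a a' = min c c'"
        with calculation have "{a, a'} = {c, c'}" by (metis mm)
        moreover have "b' = b" "d = b" "d' = b" using hh by (metis of_int_eq_iff)+
        ultimately have "{p, q} = {r, s}"
          unfolding p q r s by (auto simp: doubleton_eq_iff)
        then show False using a(3) by blast
      qed
      ultimately have "max a a' \<le> min c c' \<or> max c c' \<le> min a a'" by linarith
      then have "of_int (max a a') \<le> (of_int (min c c') :: real) \<or>
          of_int (max c c') \<le> (of_int (min a a') :: real)"
        unfolding of_int_le_iff .
      with hh have "Re z = of_int (max a a') \<or> Re z = of_int (min a a')"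
        by (meson order_antisym order_trans)
      then have "Re z = of_int a \<or> Re z = of_int a'"
        by (metis max_def min_def)
      then show ?thesis using hh(1) by (metis complex_eq_iff Re_emb Im_emb fst_conv snd_conv p q)
    next
      case vh
      then have "of_int (min b b') \<le> (of_int d :: real)" "(of_int d :: real) \<le> of_int (max b b')"
        by metis+
      then have "min b b' \<le> d" "d \<le> max b b'" unfolding of_int_le_iff .
      moreover have "\<bar>b - b'\<bar> = 1" using vh(1) by blast
      ultimately have "d = b \<or> d = b'" by linarith
      then show ?thesis using vh by (metis complex_eq_iff Re_emb Im_emb fst_conv snd_conv p q)
    next
      case hv
      then have "of_int (min a a') \<le> (of_int c :: real)" "(of_int c :: real) \<le> of_int (max a a')"
        by metis+
      then have "min a a' \<le> c" "c \<le> max a a'" unfolding of_int_le_iff .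
      moreover have "\<bar>a - a'\<bar> = 1" using hv(1) by blast
      ultimately have "c = a \<or> c = a'" by linarith
      then show ?thesis using hv by (metis complex_eq_iff Re_emb Im_emb fst_conv snd_conv p q)
    qed
  qed
  show ?thesis
    using *[OF assms] *[OF assms(2,1) assms(3)[symmetric] assms(5,4)] by auto
qed

section \<open>Lattice cycles as closed polygonal paths\<close>

definition edges :: "'a list \<Rightarrow> ('a \<times> 'a) list" where
  "edges xs = zip xs (tl xs)"

lemma edges_simps [simp]:
  "edges [] = []" "edges [u] = []" "edges (u # v # xs) = (u, v) # edges (v # xs)"
  by (simp_all add: edges_def)

lemma edges_map: "edges (map f xs) = map (\<lambda>(u, v). (f u, f v)) (edges xs)"
  by (induction xs rule: induct_list012) simp_all

lemma edges_conv_nth: "edges xs = map (\<lambda>i. (xs ! i, xs ! Suc i)) [0..<length xs - 1]"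
  by (rule nth_equalityI) (auto simp: edges_def nth_tl)

lemma set_edgesD: "(u, v) \<in> set (edges xs) \<Longrightarrow> u \<in> set xs \<and> v \<in> set xs"
  by (auto simp: edges_conv_nth)

lemma is_cycle_edges: "is_cycle \<gamma> \<Longrightarrow> e \<in> set (edges \<gamma>) \<Longrightarrow> e \<in> arcs"
  by (auto simp: is_cycle_def edges_conv_nth)

lemma flow_eq_sum_list:
  "flow \<gamma> a = (\<Sum>(u, v)\<leftarrow>edges \<gamma>. of_bool (a = (u, v)) - of_bool (a = (v, u)))"
  unfolding flow_def edges_conv_nth
  by (simp add: interv_sum_list_conv_sum_set_nat atLeast0LessThan comp_def)

lemma flow_swap: "flow \<gamma> (y, x) = - flow \<gamma> (x, y)"
  by (simp add: flow_def sum_subtractf conj_commute)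

text \<open>On a closed path this sum is zero. It serves to cancel the increments of a branch of the
  logarithm along a cycle.\<close>

lemma sum_list_edges_telescope:
  fixes G :: "'a \<Rightarrow> 'b::ab_group_add"
  shows "xs \<noteq> [] \<Longrightarrow> (\<Sum>(u, v)\<leftarrow>edges xs. G v - G u) = G (last xs) - G (hd xs)"
  by (induction xs rule: induct_list012) auto

lemma pathstart_poly_path: "zs \<noteq> [] \<Longrightarrow> pathstart (poly_path zs) = hd zs"
  by (induction zs rule: poly_path.induct) auto

lemma pathfinish_poly_path: "zs \<noteq> [] \<Longrightarrow> pathfinish (poly_path zs) = last zs"
  by (induction zs rule: poly_path.induct) auto

lemma path_poly_path: "path (poly_path zs)"
  by (induction zs rule: poly_path.induct) (simp_all only: poly_path.simps path_linepath path_join pathstart_poly_path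
      list.distinct pathfinish_linepath list.sel not_False_eq_True)

lemma path_image_poly_path:
  "length zs \<ge> 2 \<Longrightarrow> path_image (poly_path zs) = (\<Union>(u, v) \<in> set (edges zs). closed_segment u v)"
  by (induction zs rule: poly_path.induct) (auto simp: pathstart_poly_path path_image_join)

lemma path_image_poly_path_emb:
  "length xs \<ge> 2 \<Longrightarrow> path_image (poly_path (map emb xs)) =
     (\<Union>(u, v) \<in> set (edges xs). closed_segment (emb u) (emb v))"
  by (subst path_image_poly_path) (auto simp: edges_map)

lemma winding_number_poly_path:
  assumes "length zs \<ge> 2" "z \<notin> path_image (poly_path zs)"
  shows "winding_number (poly_path zs) z = (\<Sum>(u, v)\<leftarrow>edges zs. winding_number (linepath u v) z)"
  using assms
proof (induction zs rule: poly_path.induct)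
  case (4 u v w zs)
  then show ?case
    by (simp add: pathstart_poly_path path_image_join winding_number_join path_poly_path)
qed auto

text \<open>The first vertex does not occur again, so the first edge is none of the later ones and
  can meet them only in a common vertex, the joint.\<close>

lemma arc_poly_path:
  assumes "length xs \<ge> 2" "distinct xs" "set (edges xs) \<subseteq> arcs"
  shows "arc (poly_path (map emb xs))"
  using assms
proof (induction xs rule: induct_list012)
  case (3 u v xs')
  show ?case
  proof (cases xs')
    case Nil
    with 3 show ?thesis by (auto intro!: arc_linepath)
  next
    case (Cons w xs)
    note 4 = 3[unfolded Cons]
  let ?r = "poly_path (map emb (v # w # xs))"
  have "arc ?r" using 4 by auto
  moreover have "arc (linepath (emb u) (emb v))" using 4 by (auto intro!: arc_linepath)
  moreover have "path_image (linepath (emb u) (emb v)) \<inter> path_image ?r \<subseteq> {pathstart ?r}"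
  proof
    fix z assume z: "z \<in> path_image (linepath (emb u) (emb v)) \<inter> path_image ?r"
    then obtain r s where rs: "(r, s) \<in> set (edges (v # w # xs))" "z \<in> closed_segment (emb r) (emb s)"
      by (subst (asm) path_image_poly_path_emb) (auto simp del: edges_simps)
    have "r \<noteq> u" "s \<noteq> u" using set_edgesD[OF rs(1)] 4 by auto
    then have "\<exists>w \<in> {u, v} \<inter> {r, s}. z = emb w"
      using z 4 rs by (intro edges_meet_at_vertices) auto
    then show "z \<in> {pathstart ?r}"
      using \<open>r \<noteq> u\<close> \<open>s \<noteq> u\<close> by (auto simp: pathstart_poly_path)
  qed
  ultimately show ?thesis
    by (auto intro!: arc_join simp: pathstart_poly_path Cons)
  qed
qed auto

text \<open>Without its first edge the cycle is an arc, and that edge closes it to a loop. The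
  length bound excludes the path that runs along an edge and straight back, which is not
  simple.\<close>

lemma simple_path_curve:
  assumes "is_cycle \<gamma>" "length \<gamma> \<ge> 4"
  shows "simple_path (curve \<gamma>)"
proof -
  obtain p q r s ys where \<gamma>: "\<gamma> = p # q # r # s # ys"
    using assms(2) by (auto simp: numeral_eq_Suc Suc_le_length_iff)
  let ?rest = "q # r # s # ys"
  let ?r = "poly_path (map emb ?rest)"
  have last: "last ?rest = p" and dist: "distinct (p # butlast ?rest)"
    and e: "set (edges \<gamma>) \<subseteq> arcs"
    using assms is_cycle_edges[OF assms(1)] by (auto simp: \<gamma> is_cycle_def)
  have "?rest = butlast ?rest @ [p]"
    using last by (metis append_butlast_last_id list.distinct(1))
  moreover have "distinct (butlast ?rest @ [p])" using dist by auto
  ultimately have drest: "distinct ?rest" by metis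
  have "arc ?r" by (rule arc_poly_path) (use drest e in \<open>auto simp: \<gamma>\<close>)
  moreover have "arc (linepath (emb p) (emb q))" using e arcs_neq by (auto intro!: arc_linepath simp: \<gamma>)
  moreover have "path_image (linepath (emb p) (emb q)) \<inter> path_image ?r \<subseteq> {emb p, emb q}"
  proof
    fix z assume z: "z \<in> path_image (linepath (emb p) (emb q)) \<inter> path_image ?r"
    then obtain t u where tu: "(t, u) \<in> set (edges ?rest)" "z \<in> closed_segment (emb t) (emb u)"
      by (subst (asm) path_image_poly_path_emb) (auto simp del: edges_simps)
    have "{p, q} \<noteq> {t, u}"
    proof
      assume eq: "{p, q} = {t, u}"
      have "q \<notin> set (r # s # ys)" using drest by auto
      \<comment> \<open>\<open>q\<close> opens \<open>?rest\<close> and does not recur, so the only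
        edge of \<open>?rest\<close> at \<open>q\<close> is the one that leaves it. If that edge led
        back to \<open>p\<close>, then \<open>p\<close> would be visited before the end.\<close>
      then have "(t, u) = (q, r)"
        using eq tu(1) set_edgesD[of t u "r # s # ys"] by (auto simp: doubleton_eq_iff)
      then have "p = r" using eq \<open>q \<notin> _\<close> by (auto simp: doubleton_eq_iff)
      then show False using dist by (auto split: if_splits)
    qed
    then show "z \<in> {emb p, emb q}"
      using edges_meet_at_vertices[of p q t u z] tu e z by (auto simp: \<gamma>)
  qed
  ultimately have "simple_path (linepath (emb p) (emb q) +++ ?r)"
    using last by (intro simple_path_join_loop) (auto simp: pathstart_poly_path pathfinish_poly_path last_map)
  then show ?thesis by (simp add: \<gamma> curve_def)
qed

section \<open>Face weights as winding numbers\<close>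

lemma square_avoids_edge:
  assumes "(p, q) \<in> arcs" "z \<in> unit_square x"
  shows "z \<notin> closed_segment (emb p) (emb q)"
proof
  assume "z \<in> closed_segment (emb p) (emb q)"
  moreover have "\<not> (of_int k < (of_int m :: real) \<and> (of_int m :: real) < of_int (k + 1))" for k m :: int
    unfolding of_int_less_iff by linarith
  ultimately show False
    using edge_coords[OF assms(1)] assms(2) unfolding unit_square_def in_box_complex_iff
    by (fastforce simp: in_box_complex_iff)
qed

text \<open>The square lies in one component of the complement of the curve, hence inside or outside
  as a whole. A simple closed curve winds once around all inside points, always in the same
  direction, and zero times around outside points.\<close>

lemma face_weight_eq_winding_number:
  assumes "is_cycle \<gamma>" "length \<gamma> \<ge> 4"
  shows "winding_number (curve \<gamma>) (centre x) = of_real (face_weight \<gamma> x)"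
proof -
  let ?S = "path_image (curve \<gamma>)"
  have sq: "unit_square x \<subseteq> - ?S"
  proof -
    have "?S = (\<Union>(u, v) \<in> set (edges \<gamma>). closed_segment (emb u) (emb v))"
      unfolding curve_def using assms(2) by (intro path_image_poly_path_emb) simp
    moreover have "z \<notin> closed_segment (emb u) (emb v)" if "z \<in> unit_square x" "(u, v) \<in> set (edges \<gamma>)" for z u v
      using square_avoids_edge is_cycle_edges[OF assms(1)] that by blast
    ultimately show ?thesis by blast
  qed
  have c: "centre x \<in> unit_square x"
    by (auto simp: centre_def unit_square_def in_box_complex_iff)
  have conn: "connected (unit_square x)"
    unfolding unit_square_def by (intro convex_connected convex_box)
  have sub: "unit_square x \<subseteq> region \<gamma> \<longleftrightarrow> centre x \<in> region \<gamma>"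
  proof
    assume "centre x \<in> region \<gamma>"
    moreover have "connected_component (- ?S) (centre x) z" if "z \<in> unit_square x" for z
      unfolding connected_component_def using c conn sq that by blast
    ultimately show "unit_square x \<subseteq> region \<gamma>"
      unfolding region_def using inside_same_component by blast
  qed (use c in blast)
  have sp: "simple_path (curve \<gamma>)" using simple_path_curve assms by blast
  show ?thesis
  proof (cases "centre x \<in> region \<gamma>")
    case True
    show ?thesis
    proof (rule simple_closed_path_winding_number_inside[OF sp])
      assume "\<And>z. z \<in> inside ?S \<Longrightarrow> winding_number (curve \<gamma>) z = 1"
      then show ?thesis
        using True sub by (simp add: face_weight_def runs_ccw_def region_def)
    next
      assume cw: "\<And>z. z \<in> inside ?S \<Longrightarrow> winding_number (curve \<gamma>) z = -1"
      \<comment> \<open>On an empty region both orientations would hold vacuously; the centre shows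
        that the region is not empty.\<close>
      then have "\<not> runs_ccw \<gamma>" "runs_cw \<gamma>"
        using True by (auto simp: runs_ccw_def runs_cw_def region_def intro!: bexI[of _ "centre x"])
      then show ?thesis
        using True sub cw by (simp add: face_weight_def region_def)
    qed
  next
    case False
    then have "centre x \<in> outside ?S"
      using c sq inside_Un_outside unfolding region_def by blast
    moreover have "pathfinish (curve \<gamma>) = pathstart (curve \<gamma>)"
      using assms by (auto simp: curve_def pathstart_poly_path pathfinish_poly_path is_cycle_def
          last_map hd_map)
    ultimately show ?thesis
      using False sub sp by (simp add: face_weight_def winding_number_zero_in_outside simple_path_imp_path)
  qed
qed

text \<open>Off the segment from \<open>L\<close> to \<open>R\<close> the principal branch of \<open>Ln ((z - L) / (z - R))\<close> is holomorphic, so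
  along a closed path only the edges that cross this segment contribute.\<close>

lemma winding_number_linepath_diff:
  assumes "closed_segment p q \<inter> closed_segment L R = {}"
  shows "winding_number (linepath p q) L - winding_number (linepath p q) R =
    (Ln ((q - L) / (q - R)) - Ln ((p - L) / (p - R))) / (2 * of_real pi * \<i>)"
proof -
  let ?S = "- closed_segment L R"
  have S: "z \<noteq> L" "z \<noteq> R" "(z - L) / (z - R) \<notin> \<real>\<^sub>\<le>\<^sub>0" if "z \<in> ?S" for z
  proof -
    show zL: "z \<noteq> L" and zR: "z \<noteq> R" using that by auto
    show "(z - L) / (z - R) \<notin> \<real>\<^sub>\<le>\<^sub>0"
    proof
      assume "(z - L) / (z - R) \<in> \<real>\<^sub>\<le>\<^sub>0"
      \<comment> \<open>The ratio \<open>- r\<close> places \<open>z\<close> on the segment, with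
        weight \<open>r / (1 + r)\<close> at \<open>R\<close>.\<close>
      then obtain r where r: "r \<ge> 0" "(z - L) / (z - R) = - of_real r"
        by (metis nonpos_Reals_cases minus_minus neg_0_le_iff_le of_real_minus)
      then have "z * (1 + of_real r) = L + of_real r * R"
        using zR by (simp add: field_simps)
      moreover have "1 + complex_of_real r \<noteq> 0"
        using r(1) by (metis add_nonneg_eq_0_iff of_real_1 of_real_add of_real_eq_0_iff zero_le_one zero_neq_one)
      ultimately have "z = (L + of_real r * R) / (1 + of_real r)"
        by (simp add: field_simps)
      also have "\<dots> = (1 / (1 + r)) *\<^sub>R L + (r / (1 + r)) *\<^sub>R R"
        by (simp add: scaleR_conv_of_real add_divide_distrib)
      also have "1 / (1 + r) = 1 - r / (1 + r)" using r(1) by (simp add: field_simps)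
      finally have "z = (1 - r / (1 + r)) *\<^sub>R L + (r / (1 + r)) *\<^sub>R R" .
      then have "z \<in> closed_segment L R"
        unfolding closed_segment_def using r(1) by (intro CollectI exI[of _ "r / (1 + r)"]) auto
      then show False using that by simp
    qed
  qed
  have sub: "path_image (linepath p q) \<subseteq> ?S" using assms by auto
  then have "L \<notin> path_image (linepath p q)" "R \<notin> path_image (linepath p q)" by auto
  then have "winding_number (linepath p q) L - winding_number (linepath p q) R =
    1 / (2 * of_real pi * \<i>) * (contour_integral (linepath p q) (\<lambda>w. 1 / (w - L)) -
       contour_integral (linepath p q) (\<lambda>w. 1 / (w - R)))"
    by (simp add: winding_number_valid_path right_diff_distrib)
  also have "contour_integral (linepath p q) (\<lambda>w. 1 / (w - L)) -
       contour_integral (linepath p q) (\<lambda>w. 1 / (w - R)) =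
     contour_integral (linepath p q) (\<lambda>w. 1 / (w - L) - 1 / (w - R))"
    using \<open>L \<notin> _\<close> \<open>R \<notin> _\<close>
    by (intro contour_integral_diff[symmetric] contour_integrable_continuous_linepath continuous_intros) auto
  also have "\<dots> = Ln ((q - L) / (q - R)) - Ln ((p - L) / (p - R))"
  proof (rule contour_integral_unique)
    have "((\<lambda>z. Ln ((z - L) / (z - R))) has_field_derivative 1 / (z - L) - 1 / (z - R)) (at z within ?S)"
      if "z \<in> ?S" for z
      using S[OF that] by (auto intro!: derivative_eq_intros simp: divide_simps)
    from contour_integral_primitive[of ?S, OF this, of "linepath p q"] sub
    show "((\<lambda>w. 1 / (w - L) - 1 / (w - R)) has_contour_integral
        Ln ((q - L) / (q - R)) - Ln ((p - L) / (p - R))) (linepath p q)"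
      by auto
  qed
  finally show ?thesis by simp
qed

text \<open>From the centre of a square each side is seen under a right angle and so contributes a
  quarter turn; \<open>\<epsilon>\<close> tells on which side of the edge the centre lies.\<close>

lemma winding_number_linepath_quarter:
  assumes "p \<noteq> q" and \<epsilon>: "\<epsilon> = 1 \<or> \<epsilon> = -1"
  shows "winding_number (linepath p q) ((p + q) / 2 + of_real \<epsilon> * \<i> * (q - p) / 2) = of_real \<epsilon> / 4"
    (is "winding_number _ ?c = _")
proof -
  \<comment> \<open>This similarity moves the centre to 0 and the edge to a vertical segment with
    real part 1/2, clear of the branch cut, so that the principal logarithm of \<open>?f\<close> is
    a primitive along the edge.\<close>
  let ?f = "\<lambda>z. (z - ?c) / (- of_real \<epsilon> * \<i> * (q - p))"
  have val: "?f ((1 - t) *\<^sub>R p + t *\<^sub>R q) = 1/2 + of_real \<epsilon> * \<i> * of_real (t - 1/2)" for t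
  proof -
    have "(1 - t) *\<^sub>R p + t *\<^sub>R q - ?c =
        (1/2 + of_real \<epsilon> * \<i> * of_real (t - 1/2)) * (- of_real \<epsilon> * \<i> * (q - p))"
      unfolding scaleR_conv_of_real using \<epsilon> by (elim disjE) (simp_all add: field_simps)
    moreover have "- of_real \<epsilon> * \<i> * (q - p) \<noteq> 0" using assms by auto
    ultimately show ?thesis by (metis nonzero_mult_div_cancel_right)
  qed
  have re: "Re (?f z) = 1 / 2" if z: "z \<in> closed_segment p q" for z
    using z unfolding closed_segment_def by (auto simp only: val) simp
  have c: "?c \<notin> path_image (linepath p q)" using re[of ?c] by auto
  have "((\<lambda>z. 1 / (z - ?c)) has_contour_integral Ln (?f q) - Ln (?f p)) (linepath p q)"
  proof -
    have "((\<lambda>z. Ln (?f z)) has_field_derivative 1 / (z - ?c)) (at z within closed_segment p q)"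
      if z: "z \<in> closed_segment p q" for z
    proof -
      have "?f z \<notin> \<real>\<^sub>\<le>\<^sub>0" unfolding complex_nonpos_Reals_iff re[OF z] by simp
      moreover have "z \<noteq> ?c" using c z by auto
      ultimately show ?thesis
        using assms by (auto intro!: derivative_eq_intros)
    qed
    from contour_integral_primitive[of "closed_segment p q", OF this, of "linepath p q"]
    show ?thesis by auto
  qed
  moreover have "?f q = Complex (1/2) (\<epsilon>/2)" "?f p = Complex (1/2) (-\<epsilon>/2)"
    using val[of 1] val[of 0] by (simp_all add: complex_eq_iff)
  ultimately have "contour_integral (linepath p q) (\<lambda>z. 1 / (z - ?c)) =
      Ln (Complex (1/2) (\<epsilon>/2)) - Ln (Complex (1/2) (-\<epsilon>/2))"
    by (metis contour_integral_unique)
  also have "\<dots> = 2 * \<i> * Im (Ln (Complex (1/2) (\<epsilon>/2)))"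
  proof -
    let ?w = "Complex (1/2) (\<epsilon>/2)"
    have "Complex (1/2) (-\<epsilon>/2) = cnj ?w" by (simp add: complex_eq_iff)
    moreover have "?w \<notin> \<real>\<^sub>\<le>\<^sub>0" unfolding complex_nonpos_Reals_iff by simp
    ultimately have "Ln (Complex (1/2) (-\<epsilon>/2)) = cnj (Ln ?w)" by (simp add: cnj_Ln)
    then show ?thesis by (simp add: complex_eq_iff)
  qed
  also have "Im (Ln (Complex (1/2) (\<epsilon>/2))) = arctan \<epsilon>"
    by (simp add: Arg_eq_Im_Ln[symmetric] arg_conv_arctan complex_eq_iff)
  also have "arctan \<epsilon> = \<epsilon> * pi / 4"
    using \<epsilon> by (auto simp: arctan_one arctan_minus)
  finally have I: "contour_integral (linepath p q) (\<lambda>z. 1 / (z - ?c)) = of_real \<epsilon> * of_real pi * \<i> / 2"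
    by simp
  show ?thesis
    unfolding winding_number_valid_path[OF valid_path_linepath c] I by simp
qed

text \<open>A form common to the four orientations of the arc: \<open>\<i>\<close> times half of the
  edge vector points from the midpoint to the left.\<close>

lemma centre_face_pos:
  assumes "(p, q) \<in> arcs"
  shows "centre (face_pos (p, q)) = (emb p + emb q) / 2 + \<i> * (emb q - emb p) / 2"
  using assms unfolding arcs_iff
  by (auto simp: face_pos_right face_pos_up face_pos_left face_pos_down centre_def complex_eq_iff field_simps)

lemma centre_face_neg:
  assumes "(p, q) \<in> arcs"
  shows "centre (face_neg (p, q)) = (emb p + emb q) / 2 - \<i> * (emb q - emb p) / 2"
  using assms unfolding arcs_iff
  by (auto simp: face_neg_right face_neg_up face_neg_left face_neg_down centre_def complex_eq_iff field_simps)

text \<open>The second segment is the dual edge, which joins the centres of the two squares at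
  \<open>(p, q)\<close>. One coordinate of its points is a fixed half-integer, the other stays
  within 1/2 of the line of \<open>(p, q)\<close>. A lattice edge that meets it is therefore
  parallel to \<open>(p, q)\<close>, lies on the same line and covers its midpoint.\<close>

lemma edge_avoids_dual_edge:
  assumes "(p, q) \<in> arcs" "(u, v) \<in> arcs" "{u, v} \<noteq> {p, q}"
  shows "closed_segment (emb u) (emb v) \<inter>
     closed_segment ((emb p + emb q) / 2 + \<i> * (emb q - emb p) / 2)
                    ((emb p + emb q) / 2 - \<i> * (emb q - emb p) / 2) = {}"
proof (rule ccontr)
  let ?L = "(emb p + emb q) / 2 + \<i> * (emb q - emb p) / 2"
  let ?R = "(emb p + emb q) / 2 - \<i> * (emb q - emb p) / 2"
  assume "\<not> ?thesis"
  then obtain z where z: "z \<in> closed_segment (emb u) (emb v)" "z \<in> closed_segment ?L ?R" by blast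
  from z(2) obtain t where t: "0 \<le> t" "t \<le> 1" "z = (1 - t) *\<^sub>R ?L + t *\<^sub>R ?R"
    by (auto simp: closed_segment_def)
  \<comment> \<open>Signed position on the dual edge: 1/2 at \<open>?L\<close>, 0 at the midpoint of
    \<open>(p, q)\<close>, -1/2 at \<open>?R\<close>.\<close>
  define s where "s = (1 - 2 * t) / 2"
  have s: "\<bar>s\<bar> \<le> 1 / 2" using t by (auto simp: s_def)
  have "z = (emb p + emb q) / 2 + s *\<^sub>R (\<i> * (emb q - emb p))"
    unfolding t(3) s_def scaleR_conv_of_real by (simp add: field_simps)
  note zs = this
  have Re: "Re z = (of_int (fst p) + of_int (fst q)) / 2 - s * (of_int (snd q) - of_int (snd p))"
    and Im: "Im z = (of_int (snd p) + of_int (snd q)) / 2 + s * (of_int (fst q) - of_int (fst p))"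
    unfolding zs by (simp_all add: algebra_simps)
  have odd: "False" if "of_int k = (of_int m + of_int n) / (2 :: real)" "\<bar>m - n\<bar> = 1" for k m n :: int
  proof -
    have "of_int (2 * k) = (of_int (m + n) :: real)" using that by simp
    then have "2 * k = m + n" by (simp only: of_int_eq_iff)
    then show False using that(2) by presburger
  qed
  have eq: "k = m" if "of_int k = of_int m + s * r" "\<bar>r\<bar> = 1" for k m :: int and r :: real
  proof -
    have "\<bar>s * r\<bar> \<le> 1 / 2" using s that(2) by (simp add: abs_mult)
    then show ?thesis using that(1) by linarith
  qed
  have mid: "{k, l} = {m, n}"
    if "of_int (min k l) \<le> (of_int m + of_int n) / (2::real)"
       "(of_int m + of_int n) / (2::real) \<le> of_int (max k l)" "\<bar>k - l\<bar> = 1" "\<bar>m - n\<bar> = 1"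
     for k l m n :: int
  proof -
    have "of_int (2 * min k l) \<le> (of_int (m + n) :: real)" "(of_int (m + n) :: real) \<le> of_int (2 * max k l)"
      using that by simp_all
    then have "2 * min k l \<le> m + n" "m + n \<le> 2 * max k l" by (simp_all only: of_int_le_iff)
    then have "k = m \<and> l = n \<or> k = n \<and> l = m" using that(3,4) by linarith
    then show ?thesis by auto
  qed
  have "fst p = fst q \<and> \<bar>snd p - snd q\<bar> = 1 \<or> snd p = snd q \<and> \<bar>fst p - fst q\<bar> = 1"
    using assms(1) by (auto simp: arcs_def)
  then show False
  proof (elim disjE conjE)
    assume a: "fst p = fst q" "\<bar>snd p - snd q\<bar> = 1"
    have r: "\<bar>of_int (snd p) - of_int (snd q) :: real\<bar> = 1"
      using a(2) by (metis of_int_1 of_int_abs of_int_diff)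
    have Re': "Re z = of_int (fst p) + s * (of_int (snd p) - of_int (snd q))"
      and Im': "Im z = (of_int (snd p) + of_int (snd q)) / 2"
      using Re Im a(1) by (simp_all add: algebra_simps)
    show False using edge_coords[OF assms(2) z(1)]
    proof (elim disjE conjE)
      assume b: "fst u = fst v" "\<bar>snd u - snd v\<bar> = 1" "Re z = of_int (fst u)"
         "of_int (min (snd u) (snd v)) \<le> Im z" "Im z \<le> of_int (max (snd u) (snd v))"
      have "fst u = fst p" using eq Re' b(3) r by metis
      moreover have "{snd u, snd v} = {snd p, snd q}"
        using mid[of "snd u" "snd v" "snd p" "snd q"] b a Im' by simp
      ultimately show False using a b assms(3) by (auto simp: doubleton_eq_iff prod_eq_iff)
    next
      assume "Im z = of_int (snd u)"
      then show False using odd[of "snd u" "snd p" "snd q"] a Im' by simp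
    qed
  next
    assume a: "snd p = snd q" "\<bar>fst p - fst q\<bar> = 1"
    have r: "\<bar>of_int (fst q) - of_int (fst p) :: real\<bar> = 1"
      using a(2) by (metis of_int_1 of_int_abs of_int_diff abs_minus_commute)
    have Im': "Im z = of_int (snd p) + s * (of_int (fst q) - of_int (fst p))"
      and Re': "Re z = (of_int (fst p) + of_int (fst q)) / 2"
      using Re Im a(1) by (simp_all add: algebra_simps)
    show False using edge_coords[OF assms(2) z(1)]
    proof (elim disjE conjE)
      assume b: "snd u = snd v" "\<bar>fst u - fst v\<bar> = 1" "Im z = of_int (snd u)"
         "of_int (min (fst u) (fst v)) \<le> Re z" "Re z \<le> of_int (max (fst u) (fst v))"
      have "snd u = snd p" using eq Im' b(3) r by metis
      moreover have "{fst u, fst v} = {fst p, fst q}"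
        using mid[of "fst u" "fst v" "fst p" "fst q"] b a Re' by simp
      ultimately show False using a b assms(3) by (auto simp: doubleton_eq_iff prod_eq_iff)
    next
      assume "Re z = of_int (fst u)"
      then show False using odd[of "fst u" "fst p" "fst q"] a Re' by simp
    qed
  qed
qed

text \<open>Away from the dual edge the difference of the two winding numbers is an increment of the
  principal logarithm. Along \<open>(p, q)\<close> the ratio runs from \<open>\<i>\<close> through
  -1 to \<open>- \<i>\<close>, across the branch cut: the logarithm yields -1/2 where the true
  difference is 1/4 + 1/4, and the correction is one full turn.\<close>

lemma winding_number_edge_jump:
  fixes p q :: pt
  defines "L \<equiv> centre (face_pos (p, q))" and "R \<equiv> centre (face_neg (p, q))"
  assumes a: "(p, q) \<in> arcs" and e: "(u, v) \<in> arcs"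
  shows "winding_number (linepath (emb u) (emb v)) L - winding_number (linepath (emb u) (emb v)) R =
    (Ln ((emb v - L) / (emb v - R)) - Ln ((emb u - L) / (emb u - R))) / (2 * of_real pi * \<i>) +
    (of_bool ((p, q) = (u, v)) - of_bool ((p, q) = (v, u)))"
proof (cases "{u, v} = {p, q}")
  case False
  then show ?thesis
    using winding_number_linepath_diff[OF edge_avoids_dual_edge[OF a e]]
    unfolding L_def R_def centre_face_pos[OF a] centre_face_neg[OF a] by auto
next
  case True
  have pq: "p \<noteq> q" using a arcs_neq by blast
  \<comment> \<open>From an end of the edge the two centres are seen at equal distance and at a
    right angle, so the ratios are quarter turns.\<close>
  have q: "(emb q - L) / (emb q - R) = - \<i>" and p: "(emb p - L) / (emb p - R) = \<i>"
  proof -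
    have "emb q - L = - \<i> * (emb q - R)" "emb p - L = \<i> * (emb p - R)"
      unfolding L_def R_def centre_face_pos[OF a] centre_face_neg[OF a] by (simp_all add: field_simps)
    moreover have "emb q - R = (1 + \<i>) * (emb q - emb p) / 2" "emb p - R = (\<i> - 1) * (emb q - emb p) / 2"
      unfolding R_def centre_face_neg[OF a] by (simp_all add: field_simps)
    moreover have "1 + \<i> \<noteq> 0" "\<i> - 1 \<noteq> 0" by (simp_all add: complex_eq_iff)
    then have "(1 + \<i>) * (emb q - emb p) / 2 \<noteq> 0" "(\<i> - 1) * (emb q - emb p) / 2 \<noteq> 0"
      using pq by simp_all
    ultimately have "emb q - R \<noteq> 0" "emb p - R \<noteq> 0" by metis+
    with \<open>emb q - L = _\<close> \<open>emb p - L = _\<close>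
    show "(emb q - L) / (emb q - R) = - \<i>" "(emb p - L) / (emb p - R) = \<i>"
      by (metis nonzero_mult_div_cancel_right)+
  qed
  consider "(u, v) = (p, q)" | "(u, v) = (q, p)" using True by (auto simp: doubleton_eq_iff)
  then show ?thesis
  proof cases
    case 1
    have w1: "winding_number (linepath (emb p) (emb q)) L = 1 / 4"
      using winding_number_linepath_quarter[of "emb p" "emb q" 1] pq
      by (simp add: L_def centre_face_pos[OF a])
    have w2: "winding_number (linepath (emb p) (emb q)) R = - 1 / 4"
      using winding_number_linepath_quarter[of "emb p" "emb q" "-1"] pq
      by (simp add: R_def centre_face_neg[OF a])
    have uv: "u = p" "v = q" using 1 by auto
    show ?thesis unfolding uv w1 w2 p q using pq by simp
  next
    case 2
    have w1: "winding_number (linepath (emb q) (emb p)) L = - 1 / 4"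
      using winding_number_linepath_quarter[of "emb q" "emb p" "-1"] pq
      by (simp add: L_def centre_face_pos[OF a] algebra_simps diff_divide_distrib)
    have w2: "winding_number (linepath (emb q) (emb p)) R = 1 / 4"
      using winding_number_linepath_quarter[of "emb q" "emb p" 1] pq
      by (simp add: R_def centre_face_neg[OF a] algebra_simps diff_divide_distrib)
    have uv: "u = q" "v = p" using 2 by auto
    show ?thesis unfolding uv w1 w2 p q using pq by simp
  qed
qed

text \<open>Along the cycle the logarithms telescope to zero and the full turns add up to the flow.
  One-point and back-and-forth cycles are not Jordan curves; their image is convex, so they enclose
  nothing, and their flow vanishes.\<close>

lemma flow_eq_face_weight:
  assumes "is_cycle \<gamma>" "a \<in> arcs"
  shows "flow \<gamma> a = face_weight \<gamma> (face_pos a) - face_weight \<gamma> (face_neg a)"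
proof (cases "length \<gamma> \<ge> 4")
  case False
  then have "(\<exists>p. \<gamma> = [p]) \<or> (\<exists>p q. \<gamma> = [p, q]) \<or> (\<exists>p q r. \<gamma> = [p, q, r])"
    using assms(1) unfolding is_cycle_def
    by (cases \<gamma>; cases "tl \<gamma>"; cases "tl (tl \<gamma>)"; cases "tl (tl (tl \<gamma>))") auto
  moreover have "\<gamma> \<noteq> [p, q]" for p q
    using assms(1) arcs_neq[of p p] by (auto simp: is_cycle_def)
  moreover have "r = p" if "\<gamma> = [p, q, r]" for p q r
    using assms(1) that by (simp add: is_cycle_def)
  ultimately have deg: "(\<exists>p. \<gamma> = [p]) \<or> (\<exists>p q. \<gamma> = [p, q, p])" by metis
  then have "convex (path_image (curve \<gamma>))"
    by (auto simp: curve_def path_image_join closed_segment_commute)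
  then have "region \<gamma> = {}" by (simp add: region_def inside_convex)
  then have "face_weight \<gamma> x = 0" for x
    by (auto simp: face_weight_def unit_square_def box_eq_empty Basis_complex_def)
  moreover have "flow \<gamma> a = 0" using deg by (auto simp: flow_eq_sum_list)
  ultimately show ?thesis by simp
next
  case True
  obtain p q where a: "a = (p, q)" by (rule prod.exhaust)
  let ?L = "centre (face_pos a)" and ?R = "centre (face_neg a)"
  let ?G = "\<lambda>u. Ln ((emb u - ?L) / (emb u - ?R)) / (2 * of_real pi * \<i>)"
  have wn: "winding_number (curve \<gamma>) (centre x) =
      (\<Sum>(u, v)\<leftarrow>edges \<gamma>. winding_number (linepath (emb u) (emb v)) (centre x))" for x
  proof -
    have "centre x \<notin> closed_segment (emb u) (emb v)" if "(u, v) \<in> set (edges \<gamma>)" for u v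
      using square_avoids_edge[of u v "centre x" x] is_cycle_edges[OF assms(1) that]
      by (simp add: centre_def unit_square_def in_box_complex_iff)
    then have "centre x \<notin> path_image (curve \<gamma>)"
      using True unfolding curve_def by (subst path_image_poly_path_emb) auto
    then show ?thesis
      using True unfolding curve_def
      by (subst winding_number_poly_path) (auto simp: edges_map comp_def case_prod_unfold)
  qed
  have of_real_sum: "(\<Sum>(u, v)\<leftarrow>xs. of_bool (a = (u, v)) - of_bool (a = (v, u))) =
      complex_of_real (\<Sum>(u, v)\<leftarrow>xs. of_bool (a = (u, v)) - of_bool (a = (v, u)))" for xs
    by (induction xs) (auto simp: case_prod_unfold)
  have "complex_of_real (face_weight \<gamma> (face_pos a) - face_weight \<gamma> (face_neg a)) =
      winding_number (curve \<gamma>) ?L - winding_number (curve \<gamma>) ?R"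
    using face_weight_eq_winding_number[OF assms(1) True] by simp
  also have "\<dots> = (\<Sum>(u, v)\<leftarrow>edges \<gamma>. winding_number (linepath (emb u) (emb v)) ?L -
      winding_number (linepath (emb u) (emb v)) ?R)"
    unfolding wn by (simp add: sum_list_subtractf case_prod_unfold)
  also have "\<dots> = (\<Sum>(u, v)\<leftarrow>edges \<gamma>. (?G v - ?G u) + (of_bool (a = (u, v)) - of_bool (a = (v, u))))"
  proof (intro arg_cong[where f = sum_list] map_cong refl, clarify)
    fix u1 u2 v1 v2 assume "((u1, u2), (v1, v2)) \<in> set (edges \<gamma>)"
    then show "winding_number (linepath (emb (u1, u2)) (emb (v1, v2))) ?L -
       winding_number (linepath (emb (u1, u2)) (emb (v1, v2))) ?R =
       (?G (v1, v2) - ?G (u1, u2)) + (of_bool (a = ((u1, u2), (v1, v2))) - of_bool (a = ((v1, v2), (u1, u2))))"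
      using winding_number_edge_jump[of p q "(u1, u2)" "(v1, v2)"] is_cycle_edges[OF assms(1)] assms(2)
      unfolding a diff_divide_distrib by blast
  qed
  also have "\<dots> = (\<Sum>(u, v)\<leftarrow>edges \<gamma>. ?G v - ?G u) +
      (\<Sum>(u, v)\<leftarrow>edges \<gamma>. of_bool (a = (u, v)) - of_bool (a = (v, u)))"
    by (simp add: sum_list_addf case_prod_unfold)
  also have "(\<Sum>(u, v)\<leftarrow>edges \<gamma>. ?G v - ?G u) = 0"
    using assms(1) by (subst sum_list_edges_telescope) (auto simp: is_cycle_def)
  also have "(\<Sum>(u, v)\<leftarrow>edges \<gamma>. of_bool (a = (u, v)) - of_bool (a = (v, u))) = complex_of_real (flow \<gamma> a)"
    unfolding flow_eq_sum_list of_real_sum ..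
  finally have "complex_of_real (face_weight \<gamma> (face_pos a) - face_weight \<gamma> (face_neg a)) =
      complex_of_real (flow \<gamma> a)" by simp
  then show ?thesis by (simp only: of_real_eq_iff)
qed

section \<open>The law of the walk and its avoidance probabilities\<close>

definition nbrs :: "pt \<Rightarrow> pt set" where
  "nbrs x = {x + (1, 0), x - (1, 0), x + (0, 1), x - (0, 1)}"

lemma arcs_iff_nbrs: "(x, y) \<in> arcs \<longleftrightarrow> y \<in> nbrs x"
  by (auto simp: arcs_iff nbrs_def)

lemma arcs_nbrs: "{y. (x, y) \<in> arcs} = nbrs x"
  by (auto simp: arcs_iff_nbrs)

lemma finite_nbrs [simp]: "finite (nbrs x)"
  by (simp add: nbrs_def)

lemma sum_nbrs:
  fixes f :: "pt \<Rightarrow> real"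
  shows "sum f (nbrs x) = f (x + (1, 0)) + f (x - (1, 0)) + f (x + (0, 1)) + f (x - (0, 1))"
  by (cases x) (auto simp: nbrs_def)

lemma jump_nonneg:
  assumes "\<And>a. a \<in> arcs \<Longrightarrow> 0 \<le> c a"
  shows "0 \<le> jump c x y"
  unfolding jump_def by (simp, intro impI divide_nonneg_nonneg sum_nonneg assms) simp_all

lemma jump_notin: "y \<notin> nbrs x \<Longrightarrow> jump c x y = 0"
  by (simp add: jump_def arcs_iff_nbrs)

lemma sum_jump:
  assumes "(\<Sum>y\<in>nbrs x. c (x, y)) > 0"
  shows "(\<Sum>y\<in>nbrs x. jump c x y) = 1"
  using assms by (simp add: jump_def arcs_iff_nbrs arcs_nbrs flip: sum_divide_distrib)

definition step_pmf :: "(arc \<Rightarrow> real) \<Rightarrow> pt \<Rightarrow> pt pmf" where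
  "step_pmf c x = embed_pmf (jump c x)"

lemma pmf_step_pmf:
  assumes nn: "\<And>a. a \<in> arcs \<Longrightarrow> 0 \<le> c a" and pos: "\<And>x. (\<Sum>y\<in>nbrs x. c (x, y)) > 0"
  shows "pmf (step_pmf c x) y = jump c x y"
  unfolding step_pmf_def
proof (rule pmf_embed_pmf)
  show "\<And>y. 0 \<le> jump c x y" by (intro jump_nonneg nn)
  have "(\<integral>\<^sup>+ y. ennreal (jump c x y) \<partial>count_space UNIV) = (\<Sum>y\<in>nbrs x. ennreal (jump c x y))"
    by (rule nn_integral_count_space') (auto simp: jump_notin)
  also have "\<dots> = ennreal (\<Sum>y\<in>nbrs x. jump c x y)"
    by (intro sum_ennreal jump_nonneg nn)
  finally show "(\<integral>\<^sup>+ y. ennreal (jump c x y) \<partial>count_space UNIV) = 1"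
    using sum_jump[OF pos] by simp
qed

text \<open>The step of the walk at time \<open>n\<close> from \<open>y\<close> is read off an independent arrow at \<open>(n, y)\<close>; no arrow is used
  twice, so cylinder probabilities are products and no kernel construction is needed.\<close>

primrec stack_walk :: "pt \<Rightarrow> (nat \<times> pt \<Rightarrow> pt) \<Rightarrow> nat \<Rightarrow> pt" where
  "stack_walk x \<omega> 0 = x"
| "stack_walk x \<omega> (Suc n) = \<omega> (n, stack_walk x \<omega> n)"

lemma measurable_stack_walk:
  "(\<lambda>\<omega>. stack_walk x \<omega> n) \<in> (\<Pi>\<^sub>M i\<in>UNIV. measure_pmf (K i)) \<rightarrow>\<^sub>M count_space UNIV"
proof (induction n)
  case (Suc n)
  have "(\<lambda>\<omega>. \<omega> (n, y)) \<in> (\<Pi>\<^sub>M i\<in>UNIV. measure_pmf (K i)) \<rightarrow>\<^sub>M count_space UNIV" for y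
  proof -
    have "(\<lambda>\<omega>. \<omega> (n, y)) \<in> (\<Pi>\<^sub>M i\<in>UNIV. measure_pmf (K i)) \<rightarrow>\<^sub>M measure_pmf (K (n, y))"
      by (rule measurable_component_singleton) simp
    then show ?thesis by simp
  qed
  from measurable_compose_countable[OF this Suc] show ?case by simp
qed simp

text \<open>The arrows on the right carry different times, so following a prescribed path is a
  cylinder event in distinct independent coordinates.\<close>

lemma stack_walk_eq_iff:
  "(\<forall>i\<le>n. stack_walk x \<omega> i = \<xi> i) \<longleftrightarrow> \<xi> 0 = x \<and> (\<forall>i<n. \<omega> (i, \<xi> i) = \<xi> (Suc i))"
proof (induction n)
  case (Suc n)
  have "(\<forall>i\<le>Suc n. stack_walk x \<omega> i = \<xi> i) \<longleftrightarrow>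
      (\<forall>i\<le>n. stack_walk x \<omega> i = \<xi> i) \<and> stack_walk x \<omega> (Suc n) = \<xi> (Suc n)"
    by (auto simp: le_Suc_eq)
  also have "\<dots> \<longleftrightarrow> (\<forall>i\<le>n. stack_walk x \<omega> i = \<xi> i) \<and> \<omega> (n, \<xi> n) = \<xi> (Suc n)"
    by auto
  finally show ?case unfolding Suc by (auto simp: less_Suc_eq)
qed auto

lemma walk_law_exists:
  assumes nn: "\<And>a. a \<in> arcs \<Longrightarrow> 0 \<le> c a" and pos: "\<And>x. (\<Sum>y\<in>nbrs x. c (x, y)) > 0"
  shows "\<exists>N. walk_law c x N"
proof -
  define P where "P = (\<Pi>\<^sub>M i\<in>(UNIV :: (nat \<times> pt) set). measure_pmf (step_pmf c (snd i)))"
  define S :: "(nat \<Rightarrow> pt) measure" where "S = (\<Pi>\<^sub>M i\<in>UNIV. count_space UNIV)"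
  define N where "N = distr P S (stack_walk x)"
  interpret product_prob_space "\<lambda>i. measure_pmf (step_pmf c (snd i))" "UNIV :: (nat \<times> pt) set" ..
  have P: "prob_space P" unfolding P_def by (rule prob_space_PiM) (rule prob_space_measure_pmf)
  have meas: "stack_walk x \<in> P \<rightarrow>\<^sub>M S"
    unfolding S_def P_def by (rule measurable_PiM_single') (auto intro: measurable_stack_walk)
  have "measure N {X \<in> space N. \<forall>i\<le>n. X i = \<xi> i} =
      of_bool (\<xi> 0 = x) * (\<Prod>i<n. jump c (\<xi> i) (\<xi> (Suc i)))" for n \<xi>
  proof -
    have "{X \<in> space S. \<forall>i\<le>n. X i = \<xi> i} \<in> sets S" unfolding S_def by measurable
    then have "measure N {X \<in> space N. \<forall>i\<le>n. X i = \<xi> i} =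
        measure P (stack_walk x -` {X \<in> space S. \<forall>i\<le>n. X i = \<xi> i} \<inter> space P)"
      unfolding N_def space_distr by (rule measure_distr[OF meas])
    also have "stack_walk x -` {X \<in> space S. \<forall>i\<le>n. X i = \<xi> i} \<inter> space P =
        {\<omega>. \<xi> 0 = x \<and> (\<forall>i<n. \<omega> (i, \<xi> i) = \<xi> (Suc i))}"
      unfolding stack_walk_eq_iff[symmetric] by (auto simp: S_def P_def space_PiM)
    also have "measure P \<dots> = of_bool (\<xi> 0 = x) * (\<Prod>i<n. jump c (\<xi> i) (\<xi> (Suc i)))"
    proof (cases "\<xi> 0 = x")
      case True
      let ?J = "(\<lambda>i. (i, \<xi> i)) ` {..<n}"
      have "{\<omega>. \<xi> 0 = x \<and> (\<forall>i<n. \<omega> (i, \<xi> i) = \<xi> (Suc i))} =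
          emb UNIV ?J (Pi\<^sub>E ?J (\<lambda>j. {\<xi> (Suc (fst j))}))"
        using True by (auto simp: prod_emb_def PiE_iff space_PiM)
      then have "measure P {\<omega>. \<xi> 0 = x \<and> (\<forall>i<n. \<omega> (i, \<xi> i) = \<xi> (Suc i))} =
          (\<Prod>j\<in>?J. measure (measure_pmf (step_pmf c (snd j))) {\<xi> (Suc (fst j))})"
        unfolding P_def by (simp only:) (rule measure_PiM_emb, auto)
      also have "\<dots> = (\<Prod>i<n. jump c (\<xi> i) (\<xi> (Suc i)))"
        by (subst prod.reindex) (auto simp: inj_on_def measure_pmf_single pmf_step_pmf[OF nn pos])
      finally show ?thesis using True by simp
    qed simp
    finally show ?thesis .
  qed
  moreover have "prob_space N" unfolding N_def using P meas by (rule prob_space.prob_space_distr)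
  moreover have "sets N = sets (\<Pi>\<^sub>M i\<in>UNIV. count_space UNIV)" by (simp add: N_def S_def)
  ultimately show ?thesis unfolding walk_law_def by blast
qed

text \<open>Probability that the walk from \<open>y\<close> stays off \<open>x\<close> at the times
  1 to \<open>n\<close>. Time 0 is exempt, so that for \<open>y = x\<close> this is the probability
  of no return by time \<open>n\<close>.\<close>

primrec avoid :: "(arc \<Rightarrow> real) \<Rightarrow> pt \<Rightarrow> nat \<Rightarrow> pt \<Rightarrow> real" where
  "avoid c x 0 y = 1"
| "avoid c x (Suc n) y = (\<Sum>z\<in>nbrs y. jump c y z * (if z = x then 0 else avoid c x n z))"

lemma measurable_walk_coordinate:
  assumes "walk_law c x N"
  shows "(\<lambda>X. X i) \<in> N \<rightarrow>\<^sub>M count_space UNIV"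
proof -
  have "(\<lambda>X. X i) \<in> (\<Pi>\<^sub>M i\<in>UNIV. count_space UNIV) \<rightarrow>\<^sub>M count_space (UNIV :: pt set)"
    by (rule measurable_component_singleton) simp
  moreover have "sets N = sets (\<Pi>\<^sub>M i\<in>(UNIV :: nat set). count_space (UNIV :: pt set))"
    using assms by (simp add: walk_law_def)
  ultimately show ?thesis using measurable_cong_sets by blast
qed

text \<open>Induction on the horizon, splitting the cylinder by the next position. Recurrence asks
  for an upper bound only.\<close>

lemma walk_law_avoid_le:
  assumes N: "walk_law c x0 N"
    and nn: "\<And>a. a \<in> arcs \<Longrightarrow> 0 \<le> c a" and pos: "\<And>x. (\<Sum>y\<in>nbrs x. c (x, y)) > 0"
  shows "measure N {X \<in> space N. (\<forall>i\<le>n. X i = \<xi> i) \<and> (\<forall>i\<in>{n<..n+m}. X i \<noteq> x)}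
     \<le> measure N {X \<in> space N. \<forall>i\<le>n. X i = \<xi> i} * avoid c x m (\<xi> n)"
proof (induction m arbitrary: n \<xi>)
  case 0
  then show ?case by simp
next
  case (Suc m)
  interpret prob_space N using N by (simp add: walk_law_def)
  note [measurable] = measurable_walk_coordinate[OF N]
  let ?C = "\<lambda>n \<xi>. {X \<in> space N. \<forall>i\<le>n. X i = \<xi> i}"
  let ?E = "\<lambda>n \<xi> m. {X \<in> space N. (\<forall>i\<le>n. X i = \<xi> i) \<and> (\<forall>i\<in>{n<..n+m}. X i \<noteq> x)}"
  let ?\<xi> = "\<lambda>z. \<xi>(Suc n := z)"
  have C: "measure N (?C (Suc n) (?\<xi> z)) = measure N (?C n \<xi>) * jump c (\<xi> n) z" for z
  proof -
    have "measure N (?C (Suc n) (?\<xi> z)) =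
        of_bool (\<xi> 0 = x0) * (\<Prod>i<Suc n. jump c (?\<xi> z i) (?\<xi> z (Suc i)))"
      using N unfolding walk_law_def by simp
    also have "\<dots> = of_bool (\<xi> 0 = x0) * (\<Prod>i<n. jump c (\<xi> i) (\<xi> (Suc i))) * jump c (\<xi> n) z"
      by simp
    also have "of_bool (\<xi> 0 = x0) * (\<Prod>i<n. jump c (\<xi> i) (\<xi> (Suc i))) = measure N (?C n \<xi>)"
      using N unfolding walk_law_def by simp
    finally show ?thesis .
  qed
  \<comment> \<open>The trajectories whose next step leads to no neighbour; a null set, because the
    jump probabilities to the neighbours add up to one.\<close>
  let ?D = "?C n \<xi> - (\<Union>z\<in>nbrs (\<xi> n). ?C (Suc n) (?\<xi> z))"
  have sub: "(\<Union>z\<in>nbrs (\<xi> n). ?C (Suc n) (?\<xi> z)) \<subseteq> ?C n \<xi>"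
    by (auto simp: le_Suc_eq)
  have setsC: "?C n \<xi> \<in> sets N" for n \<xi> by measurable
  have setsE: "?E n \<xi> m \<in> sets N" for n \<xi> m by measurable
  have "measure N (\<Union>z\<in>nbrs (\<xi> n). ?C (Suc n) (?\<xi> z)) = (\<Sum>z\<in>nbrs (\<xi> n). measure N (?C (Suc n) (?\<xi> z)))"
    by (rule finite_measure_finite_Union) (use setsC in \<open>auto simp: disjoint_family_on_def\<close>)
  also have "\<dots> = measure N (?C n \<xi>)"
    using sum_jump[OF pos] unfolding C by (simp flip: sum_distrib_left)
  finally have D: "measure N ?D = 0"
    using setsC sub by (subst finite_measure_Diff) auto
  have "?E n \<xi> (Suc m) \<subseteq> (\<Union>z\<in>nbrs (\<xi> n) - {x}. ?E (Suc n) (?\<xi> z) m) \<union> ?D"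
  proof
    fix X assume X: "X \<in> ?E n \<xi> (Suc m)"
    then have "X (Suc n) \<noteq> x" by auto
    moreover have "X \<in> ?E (Suc n) (?\<xi> (X (Suc n))) m"
      using X by (auto simp: le_Suc_eq)
    moreover have "X \<in> ?D" if "X (Suc n) \<notin> nbrs (\<xi> n)"
    proof -
      have "X \<in> ?C n \<xi>" using X by blast
      moreover have "z = X (Suc n)" if "X \<in> ?C (Suc n) (?\<xi> z)" for z using that by auto
      ultimately show ?thesis using that by blast
    qed
    ultimately show "X \<in> (\<Union>z\<in>nbrs (\<xi> n) - {x}. ?E (Suc n) (?\<xi> z) m) \<union> ?D"
      by blast
  qed
  then have "measure N (?E n \<xi> (Suc m)) \<le>
      measure N ((\<Union>z\<in>nbrs (\<xi> n) - {x}. ?E (Suc n) (?\<xi> z) m) \<union> ?D)"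
    using setsC setsE by (intro finite_measure_mono) auto
  also have "\<dots> \<le> measure N (\<Union>z\<in>nbrs (\<xi> n) - {x}. ?E (Suc n) (?\<xi> z) m) + measure N ?D"
    using setsC setsE by (intro measure_Un_le) auto
  also have "\<dots> = measure N (\<Union>z\<in>nbrs (\<xi> n) - {x}. ?E (Suc n) (?\<xi> z) m)"
    using D by simp
  also have "\<dots> \<le> (\<Sum>z\<in>nbrs (\<xi> n) - {x}. measure N (?E (Suc n) (?\<xi> z) m))"
    using setsE by (intro measure_UNION_le) auto
  also have "\<dots> \<le> (\<Sum>z\<in>nbrs (\<xi> n) - {x}. measure N (?C (Suc n) (?\<xi> z)) * avoid c x m z)"
  proof (rule sum_mono)
    fix z
    show "measure N (?E (Suc n) (?\<xi> z) m) \<le> measure N (?C (Suc n) (?\<xi> z)) * avoid c x m z"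
      using Suc.IH[of "Suc n" "?\<xi> z"] unfolding fun_upd_same .
  qed
  also have "\<dots> = measure N (?C n \<xi>) * (\<Sum>z\<in>nbrs (\<xi> n) - {x}. jump c (\<xi> n) z * avoid c x m z)"
    unfolding C by (simp add: sum_distrib_left mult.assoc)
  also have "(\<Sum>z\<in>nbrs (\<xi> n) - {x}. jump c (\<xi> n) z * avoid c x m z) = avoid c x (Suc m) (\<xi> n)"
    unfolding avoid.simps by (rule sum.mono_neutral_cong_left) auto
  finally show ?case .
qed

text \<open>Never returning implies not returning up to time \<open>m\<close>, for every
  \<open>m\<close>, and the trajectories that start elsewhere than at \<open>x\<close> form a null
  set.\<close>

lemma recurrent_walkI:
  assumes nn: "\<And>a. a \<in> arcs \<Longrightarrow> 0 \<le> c a" and pos: "\<And>x. (\<Sum>y\<in>nbrs x. c (x, y)) > 0"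
    and small: "\<And>x \<epsilon>. \<epsilon> > 0 \<Longrightarrow> \<exists>m. avoid c x m x < \<epsilon>"
  shows "recurrent_walk c"
  unfolding recurrent_walk_def
proof
  fix x
  obtain N where N: "walk_law c x N" using walk_law_exists[OF nn pos] by blast
  interpret prob_space N using N by (simp add: walk_law_def)
  note [measurable] = measurable_walk_coordinate[OF N]
  let ?B = "{X \<in> space N. \<forall>i>0. X i \<noteq> x}"
  let ?E = "\<lambda>m. {X \<in> space N. (\<forall>i\<le>0. X i = x) \<and> (\<forall>i\<in>{0<..0+m}. X i \<noteq> x)}"
  have zero: "measure N {X \<in> space N. \<forall>i\<le>0. X i = x} = 1"
    using N[unfolded walk_law_def, THEN conjunct2, THEN conjunct2, rule_format, of 0 "\<lambda>_. x"]
    by simp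
  have "measure N ?B \<le> avoid c x m x" for m
  proof -
    have "?B \<subseteq> (space N - {X \<in> space N. \<forall>i\<le>0. X i = x}) \<union> ?E m" by auto
    then have "measure N ?B \<le> measure N ((space N - {X \<in> space N. \<forall>i\<le>0. X i = x}) \<union> ?E m)"
      by (intro finite_measure_mono) measurable
    also have "\<dots> \<le> measure N (space N - {X \<in> space N. \<forall>i\<le>0. X i = x}) + measure N (?E m)"
      by (intro measure_Un_le) measurable
    also have "measure N (space N - {X \<in> space N. \<forall>i\<le>0. X i = x}) = 0"
      using zero by (subst prob_compl) auto
    also have "measure N (?E m) \<le> avoid c x m x"
      using walk_law_avoid_le[OF N nn pos, of 0 "\<lambda>_. x" m x] unfolding zero by simp
    finally show ?thesis by simp
  qed
  then have "\<not> 0 < measure N ?B" using small[of "measure N ?B" x] by (meson not_le)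
  then have "measure N ?B = 0" using measure_nonneg[of N ?B] by linarith
  then have "emeasure N ?B = 0" by (simp add: emeasure_eq_measure)
  have "AE X in N. \<exists>n>0. X n = x"
  proof (rule AE_I)
    show "{X \<in> space N. \<not> (\<exists>n>0. X n = x)} \<subseteq> ?B" by blast
    show "emeasure N ?B = 0" by fact
    show "?B \<in> sets N" by measurable
  qed
  with N show "\<exists>N. walk_law c x N \<and> (AE X in N. \<exists>n>0. X n = x)" by blast
qed

section \<open>A capacity bound for divergence-free conductances\<close>

text \<open>Differences of \<open>h\<close> across the two diagonals of the square at
  \<open>x\<close> are routed along its sides: both use the bottom side, one the left and the other
  the right side. Hence the weights 2, 1, 1.\<close>

definition face_cost :: "(arc \<Rightarrow> real) \<Rightarrow> (pt \<Rightarrow> real) \<Rightarrow> pt \<Rightarrow> real" where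
  "face_cost s W x = s (x, x + (1, 0)) + s (x, x + (0, 1)) +
     (W x)\<^sup>2 * (2 / s (x, x + (1, 0)) + 1 / s (x, x + (0, 1)) + 1 / s (x + (1, 0), x + (1, 0) + (0, 1)))"

text \<open>One fixed environment, with the cycles forgotten. Both choices of the symmetric
  conductances satisfy \<open>ca_le\<close>.\<close>

locale curl_conductances =
  fixes cs ca :: "arc \<Rightarrow> real" and W :: "pt \<Rightarrow> real"
  assumes cs_sym: "(x, y) \<in> arcs \<Longrightarrow> cs (x, y) = cs (y, x)"
    and cs_pos: "a \<in> arcs \<Longrightarrow> 0 < cs a"
    and ca_curl: "a \<in> arcs \<Longrightarrow> ca a = W (face_pos a) - W (face_neg a)"
    and ca_le: "a \<in> arcs \<Longrightarrow> \<bar>ca a\<bar> \<le> cs a"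
begin

abbreviation c :: "arc \<Rightarrow> real" where "c a \<equiv> cs a + ca a"

definition s1 :: "pt \<Rightarrow> real" where "s1 x = cs (x, x + (1, 0))"
definition s2 :: "pt \<Rightarrow> real" where "s2 x = cs (x, x + (0, 1))"

lemma s_pos: "0 < s1 x" "0 < s2 x"
  unfolding s1_def s2_def by (auto intro!: cs_pos simp: arcs_iff)

lemma c_nonneg: "a \<in> arcs \<Longrightarrow> 0 \<le> c a"
  using ca_le[of a] by linarith

lemma c_right: "c (x, x + (1, 0)) = s1 x + (W x - W (x - (0, 1)))"
  by (simp add: ca_curl arcs_iff face_pos_right face_neg_right s1_def)

lemma c_up: "c (x, x + (0, 1)) = s2 x + (W (x - (1, 0)) - W x)"
  by (simp add: ca_curl arcs_iff face_pos_up face_neg_up s2_def)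

lemma c_left: "c (x + (1, 0), x) = s1 x - (W x - W (x - (0, 1)))"
  by (simp add: ca_curl arcs_iff face_pos_left face_neg_left s1_def cs_sym[of "x + (1, 0)"])

lemma c_down: "c (x + (0, 1), x) = s2 x - (W (x - (1, 0)) - W x)"
  by (simp add: ca_curl arcs_iff face_pos_down face_neg_down s2_def cs_sym[of "x + (0, 1)"])

lemma c_left': "c (x, x - (1, 0)) = s1 (x - (1, 0)) - (W (x - (1, 0)) - W (x - (1, 0) - (0, 1)))"
  using c_left[of "x - (1, 0)"] by simp

lemma c_down': "c (x, x - (0, 1)) = s2 (x - (0, 1)) - (W (x - (0, 1) - (1, 0)) - W (x - (0, 1)))"
  using c_down[of "x - (0, 1)"] by simp

text \<open>Each of the four faces around \<open>x\<close> enters with both signs, as a curl is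
  divergence free; what remains is the total of the symmetric conductances.\<close>

lemma total_pos: "0 < (\<Sum>y\<in>nbrs x. c (x, y))"
proof -
  have "(\<Sum>y\<in>nbrs x. c (x, y)) = s1 x + s1 (x - (1, 0)) + s2 x + s2 (x - (0, 1))"
    unfolding sum_nbrs c_right c_up c_left' c_down' by (cases x) simp
  then show ?thesis using s_pos[of x] s_pos[of "x - (1, 0)"] s_pos[of "x - (0, 1)"] by linarith
qed

text \<open>The generator times the stationary weight: with unnormalised conductances the pairings
  refer to counting measure, which suits summation by parts.\<close>

definition gen :: "(pt \<Rightarrow> real) \<Rightarrow> pt \<Rightarrow> real" where
  "gen h x = (\<Sum>y\<in>nbrs x. c (x, y) * (h y - h x))"

text \<open>The sides that leave \<open>x\<close> to the right and upwards represent every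
  undirected edge once.\<close>

definition dirichlet :: "(pt \<Rightarrow> real) \<Rightarrow> (pt \<Rightarrow> real) \<Rightarrow> pt \<Rightarrow> real" where
  "dirichlet F h x = s1 x * (F (x + (1, 0)) - F x) * (h (x + (1, 0)) - h x) +
     s2 x * (F (x + (0, 1)) - F x) * (h (x + (0, 1)) - h x)"

text \<open>The coefficient of \<open>W x\<close> in the antisymmetric part of the form. Only differences of \<open>F\<close> and \<open>h\<close> across
  diagonals enter, and \<open>twist h h\<close> vanishes.\<close>

definition twist :: "(pt \<Rightarrow> real) \<Rightarrow> (pt \<Rightarrow> real) \<Rightarrow> pt \<Rightarrow> real" where
  "twist F h x = (F x - F (x + (1, 1))) * (h (x + (1, 0)) - h (x + (0, 1))) -
     (F (x + (1, 0)) - F (x + (0, 1))) * (h x - h (x + (1, 1)))"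

end

text \<open>Every edge will be charged three times, once by the symmetric part and twice by faces.
  The share 1/6 makes this half of the energy, and 3/2 is the matching constant 1 / (4 *
  (1/6)).\<close>

lemma weighted_am_gm:
  fixes a b s :: real
  assumes "0 < s"
  shows "a * b \<le> 3 / 2 * (a\<^sup>2 / s) + 1 / 6 * (s * b\<^sup>2)"
proof -
  have "0 \<le> (3 * a - s * b)\<^sup>2 / (6 * s)" using assms by simp
  also have "\<dots> = 3 / 2 * (a\<^sup>2 / s) + 1 / 6 * (s * b\<^sup>2) - a * b"
    using assms by (simp add: field_simps power2_eq_square)
  finally show ?thesis by simp
qed

text \<open>A finite window with a margin around \<open>A\<close>: inside it, sums of functions
  living near \<open>A\<close> can be translated by a lattice step as if they ran over the whole
  plane.\<close>

definition nbhd :: "pt set \<Rightarrow> pt set" where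
  "nbhd A = (\<Union>a\<in>A. {fst a - 2..fst a + 2} \<times> {snd a - 2..snd a + 2})"

lemma finite_nbhd: "finite A \<Longrightarrow> finite (nbhd A)"
  by (simp add: nbhd_def)

lemma nbhd_memI: "a \<in> A \<Longrightarrow> \<bar>fst x - fst a\<bar> \<le> 2 \<Longrightarrow> \<bar>snd x - snd a\<bar> \<le> 2 \<Longrightarrow> x \<in> nbhd A"
  unfolding nbhd_def by (rule UN_I) (auto simp: mem_Times_iff)

lemma sum_shift:
  fixes f :: "pt \<Rightarrow> real"
  assumes "finite S" "\<And>x. f x \<noteq> 0 \<Longrightarrow> x \<in> S" "\<And>x. f x \<noteq> 0 \<Longrightarrow> x + e \<in> S"
  shows "(\<Sum>x\<in>S. f (x - e)) = (\<Sum>x\<in>S. f x)"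
proof -
  have "(\<Sum>x\<in>S. f (x - e)) = (\<Sum>x\<in>(\<lambda>x. x + e) ` {x. f x \<noteq> 0}. f (x - e))"
  proof (rule sum.mono_neutral_right[OF assms(1)])
    show "(\<lambda>x. x + e) ` {x. f x \<noteq> 0} \<subseteq> S" using assms(3) by blast
    show "\<forall>x\<in>S - (\<lambda>x. x + e) ` {x. f x \<noteq> 0}. f (x - e) = 0"
      by (metis (mono_tags, lifting) DiffD2 diff_add_cancel image_eqI mem_Collect_eq)
  qed
  also have "\<dots> = (\<Sum>x | f x \<noteq> 0. f x)"
    by (subst sum.reindex) (auto simp: inj_on_def)
  also have "\<dots> = (\<Sum>x\<in>S. f x)"
    using assms(1,2) by (intro sum.mono_neutral_left) blast+
  finally show ?thesis .
qed

section \<open>Summation by parts over edges and faces\<close>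

context curl_conductances begin

text \<open>The first summation by parts joins the two directions of every edge: the symmetric part
  becomes a product of increments, the asymmetric part pairs \<open>P1\<close> and \<open>P2\<close>
  with differences of \<open>W\<close>. The second moves the differences off \<open>W\<close>. The
  coefficient of \<open>W x\<close> is then the circulation of \<open>P1\<close> and
  \<open>P2\<close> around the square at \<open>x\<close>, in which the sums of \<open>F\<close>
  over the sides combine to differences across the diagonals.\<close>

lemma gen_form:
  assumes A: "finite A" and F: "\<And>x. x \<notin> A \<Longrightarrow> F x = 0" and h: "\<And>x. x \<notin> A \<Longrightarrow> h x = 0"
    and S: "finite S" "nbhd A \<subseteq> S"
  shows "- (\<Sum>x\<in>S. F x * gen h x) = (\<Sum>x\<in>S. dirichlet F h x - W x * twist F h x)"
proof -
  have supp: "x \<in> S \<and> x + (1, 0) \<in> S \<and> x + (0, 1) \<in> S"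
    if "x \<in> A \<or> x + (1, 0) \<in> A \<or> x + (0, 1) \<in> A \<or> x + (1, 1) \<in> A" for x
    by (insert that, elim disjE; intro conjI; intro subsetD[OF S(2)]; erule nbhd_memI; simp)
  define P1 where "P1 x = (F x + F (x + (1, 0))) * (h (x + (1, 0)) - h x)" for x
  define P2 where "P2 x = (F x + F (x + (0, 1))) * (h (x + (0, 1)) - h x)" for x
  define b1 where "b1 x = W x - W (x - (0, 1))" for x
  define b2 where "b2 x = W (x - (1, 0)) - W x" for x
  define f1 where "f1 x = (s1 x - b1 x) * F (x + (1, 0)) * (h x - h (x + (1, 0)))" for x
  define f2 where "f2 x = (s2 x - b2 x) * F (x + (0, 1)) * (h x - h (x + (0, 1)))" for x
  have gen: "F x * gen h x = (s1 x + b1 x) * F x * (h (x + (1, 0)) - h x) + f1 (x - (1, 0)) +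
      ((s2 x + b2 x) * F x * (h (x + (0, 1)) - h x) + f2 (x - (0, 1)))" for x
    unfolding gen_def sum_nbrs c_right c_up c_left' c_down' f1_def f2_def b1_def b2_def
    by (simp add: algebra_simps)
  have shift_f: "(\<Sum>x\<in>S. f1 (x - (1, 0))) = (\<Sum>x\<in>S. f1 x)" "(\<Sum>x\<in>S. f2 (x - (0, 1))) = (\<Sum>x\<in>S. f2 x)"
  proof -
    have "x + (1, 0) \<in> A" if "f1 x \<noteq> 0" for x
      using that F[of "x + (1, 0)"] by (auto simp: f1_def)
    then show "(\<Sum>x\<in>S. f1 (x - (1, 0))) = (\<Sum>x\<in>S. f1 x)"
      using supp by (intro sum_shift[OF S(1)]) blast+
    have "x + (0, 1) \<in> A" if "f2 x \<noteq> 0" for x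
      using that F[of "x + (0, 1)"] by (auto simp: f2_def)
    then show "(\<Sum>x\<in>S. f2 (x - (0, 1))) = (\<Sum>x\<in>S. f2 x)"
      using supp by (intro sum_shift[OF S(1)]) blast+
  qed
  have "- (\<Sum>x\<in>S. F x * gen h x) = - (\<Sum>x\<in>S. (s1 x + b1 x) * F x * (h (x + (1, 0)) - h x) + f1 x +
      ((s2 x + b2 x) * F x * (h (x + (0, 1)) - h x) + f2 x))"
    unfolding gen by (simp only: sum.distrib shift_f)
  also have "\<dots> = (\<Sum>x\<in>S. dirichlet F h x - (b1 x * P1 x + b2 x * P2 x))"
    unfolding sum_negf[symmetric] f1_def f2_def P1_def P2_def dirichlet_def
    by (rule sum.cong) (simp_all add: algebra_simps)
  also have "\<dots> = (\<Sum>x\<in>S. dirichlet F h x) - (\<Sum>x\<in>S. b1 x * P1 x + b2 x * P2 x)"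
    by (rule sum_subtractf)
  also have "(\<Sum>x\<in>S. b1 x * P1 x + b2 x * P2 x) = (\<Sum>x\<in>S. W x * twist F h x)"
  proof -
    \<comment> \<open>Both auxiliary functions serve to collect every occurrence of the value
      \<open>W x\<close> in the summand at \<open>x\<close>.\<close>
    define k1 where "k1 x = W x * P1 (x + (0, 1))" for x
    define k2 where "k2 x = W x * P2 (x + (1, 0))" for x
    have shift_k: "(\<Sum>x\<in>S. k1 (x - (0, 1))) = (\<Sum>x\<in>S. k1 x)" "(\<Sum>x\<in>S. k2 (x - (1, 0))) = (\<Sum>x\<in>S. k2 x)"
    proof -
      have "k1 x = 0" if "x + (0, 1) \<notin> A" "x + (1, 1) \<notin> A" for x
        using F[OF that(1)] F[OF that(2)] by (simp add: k1_def P1_def add.assoc)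
      then have "x + (0, 1) \<in> A \<or> x + (1, 1) \<in> A" if "k1 x \<noteq> 0" for x
        using that by blast
      then show "(\<Sum>x\<in>S. k1 (x - (0, 1))) = (\<Sum>x\<in>S. k1 x)"
        using supp by (intro sum_shift[OF S(1)]) blast+
      have "k2 x = 0" if "x + (1, 0) \<notin> A" "x + (1, 1) \<notin> A" for x
        using F[OF that(1)] F[OF that(2)] by (simp add: k2_def P2_def add.assoc)
      then have "x + (1, 0) \<in> A \<or> x + (1, 1) \<in> A" if "k2 x \<noteq> 0" for x
        using that by blast
      then show "(\<Sum>x\<in>S. k2 (x - (1, 0))) = (\<Sum>x\<in>S. k2 x)"
        using supp by (intro sum_shift[OF S(1)]) blast+
    qed
    have "(\<Sum>x\<in>S. b1 x * P1 x + b2 x * P2 x) =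
        (\<Sum>x\<in>S. (W x * P1 x - k1 (x - (0, 1))) + (k2 (x - (1, 0)) - W x * P2 x))"
      by (rule sum.cong) (simp_all add: b1_def b2_def k1_def k2_def algebra_simps)
    also have "\<dots> = (\<Sum>x\<in>S. (W x * P1 x - k1 x) + (k2 x - W x * P2 x))"
      by (simp only: sum.distrib sum_subtractf shift_k)
    also have "\<dots> = (\<Sum>x\<in>S. W x * twist F h x)"
      by (rule sum.cong) (simp_all add: k1_def k2_def P1_def P2_def twist_def add.assoc, simp add: algebra_simps)
    finally show ?thesis .
  qed
  finally show ?thesis by (simp add: sum_subtractf)
qed

text \<open>The constants make the coefficients of the energy of \<open>h\<close> add up to \<open>1 / 2\<close> after summation.\<close>

lemma form_le:
  assumes g: "\<bar>F (x + (1, 0)) - F x\<bar> \<le> g" "\<bar>F (x + (0, 1)) - F x\<bar> \<le> g"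
    "\<bar>F x - F (x + (1, 1))\<bar> \<le> g" "\<bar>F (x + (1, 0)) - F (x + (0, 1))\<bar> \<le> g"
  shows "dirichlet F h x - W x * twist F h x \<le> 3 / 2 * (g\<^sup>2 * face_cost cs W x) +
    (1 / 2 * (s1 x * (h (x + (1, 0)) - h x)\<^sup>2) + 1 / 3 * (s2 x * (h (x + (0, 1)) - h x)\<^sup>2) +
     1 / 6 * (s2 (x + (1, 0)) * (h (x + (1, 0) + (0, 1)) - h (x + (1, 0)))\<^sup>2))"
proof -
  define d1 where "d1 = \<bar>h (x + (1, 0)) - h x\<bar>"
  define d2 where "d2 = \<bar>h (x + (0, 1)) - h x\<bar>"
  define d3 where "d3 = \<bar>h (x + (1, 0) + (0, 1)) - h (x + (1, 0))\<bar>"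
  define w where "w = \<bar>W x\<bar> * g"
  have g0: "0 \<le> g" using g(1) by linarith
  have s: "0 < s1 x" "0 < s2 x" "0 < s2 (x + (1, 0))" by (rule s_pos)+
  have mult_le: "a * b \<le> g * \<bar>b\<bar>" if "\<bar>a\<bar> \<le> g" for a b :: real
    using mult_right_mono[OF that abs_ge_zero[of b]] abs_ge_self[of "a * b"] by (simp add: abs_mult)
  have "s1 x * (F (x + (1, 0)) - F x) * (h (x + (1, 0)) - h x) \<le> (s1 x * g) * d1"
    using mult_left_mono[OF mult_le[OF g(1)] less_imp_le[OF s(1)]] unfolding d1_def mult.assoc .
  moreover have "s2 x * (F (x + (0, 1)) - F x) * (h (x + (0, 1)) - h x) \<le> (s2 x * g) * d2"
    using mult_left_mono[OF mult_le[OF g(2)] less_imp_le[OF s(2)]] unfolding d2_def mult.assoc .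
  moreover have "- (W x * twist F h x) \<le> w * (d1 + d2) + w * (d1 + d3)"
  proof -
    have *: "- (W x * twist F h x) \<le> \<bar>W x\<bar> * \<bar>twist F h x\<bar>"
      using abs_ge_minus_self[of "W x * twist F h x"] by (simp add: abs_mult)
    have "\<bar>twist F h x\<bar> \<le> \<bar>(F x - F (x + (1, 1))) * (h (x + (1, 0)) - h (x + (0, 1)))\<bar> +
        \<bar>(F (x + (1, 0)) - F (x + (0, 1))) * (h x - h (x + (1, 1)))\<bar>"
      unfolding twist_def by (rule abs_triangle_ineq4)
    also have "\<dots> \<le> g * (d1 + d2) + g * (d1 + d3)"
    proof (intro add_mono)
      have "\<bar>h (x + (1, 0)) - h (x + (0, 1))\<bar> \<le> d1 + d2" unfolding d1_def d2_def by linarith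
      then show "\<bar>(F x - F (x + (1, 1))) * (h (x + (1, 0)) - h (x + (0, 1)))\<bar> \<le> g * (d1 + d2)"
        unfolding abs_mult using g(3) g0 by (intro mult_mono) auto
      have "x + (1, 0) + (0, 1) = x + (1, 1)" by (simp add: add.assoc)
      then have "d3 = \<bar>h (x + (1, 1)) - h (x + (1, 0))\<bar>" unfolding d3_def by (simp only:)
      then have "\<bar>h x - h (x + (1, 1))\<bar> \<le> d1 + d3" unfolding d1_def by linarith
      then show "\<bar>(F (x + (1, 0)) - F (x + (0, 1))) * (h x - h (x + (1, 1)))\<bar> \<le> g * (d1 + d3)"
        unfolding abs_mult using g(4) g0 by (intro mult_mono) auto
    qed
    finally have "\<bar>W x\<bar> * \<bar>twist F h x\<bar> \<le> \<bar>W x\<bar> * (g * (d1 + d2) + g * (d1 + d3))"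
      by (simp add: mult_left_mono)
    also have "\<dots> = w * (d1 + d2) + w * (d1 + d3)" by (simp add: w_def distrib_left mult.assoc)
    finally show ?thesis using * by linarith
  qed
  moreover have "(s1 x * g) * d1 \<le> 3 / 2 * (s1 x * g\<^sup>2) + 1 / 6 * (s1 x * d1\<^sup>2)"
    "(s2 x * g) * d2 \<le> 3 / 2 * (s2 x * g\<^sup>2) + 1 / 6 * (s2 x * d2\<^sup>2)"
    using weighted_am_gm[OF s(1), of "s1 x * g" d1] weighted_am_gm[OF s(2), of "s2 x * g" d2] s
    by (simp_all add: power2_eq_square field_simps)
  moreover note weighted_am_gm[OF s(1), of w d1] weighted_am_gm[OF s(2), of w d2]
    weighted_am_gm[OF s(3), of w d3]
  ultimately have "dirichlet F h x - W x * twist F h x \<le>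
     3 / 2 * (s1 x * g\<^sup>2) + 3 / 2 * (s2 x * g\<^sup>2) + 3 * (w\<^sup>2 / s1 x) + 3 / 2 * (w\<^sup>2 / s2 x) +
     3 / 2 * (w\<^sup>2 / s2 (x + (1, 0))) + (1 / 2 * (s1 x * d1\<^sup>2) + 1 / 3 * (s2 x * d2\<^sup>2) + 1 / 6 * (s2 (x + (1, 0)) * d3\<^sup>2))"
    unfolding dirichlet_def distrib_left by linarith
  also have "3 / 2 * (s1 x * g\<^sup>2) + 3 / 2 * (s2 x * g\<^sup>2) + 3 * (w\<^sup>2 / s1 x) + 3 / 2 * (w\<^sup>2 / s2 x) +
     3 / 2 * (w\<^sup>2 / s2 (x + (1, 0))) = 3 / 2 * (g\<^sup>2 * face_cost cs W x)"
    unfolding face_cost_def s1_def[symmetric] s2_def[symmetric] w_def by (simp add: power_mult_distrib distrib_left distrib_right mult.commute mult.left_commute)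
  finally show ?thesis by (simp add: d1_def d2_def d3_def)
qed

definition energy :: "(pt \<Rightarrow> real) \<Rightarrow> pt set \<Rightarrow> real" where
  "energy h S = (\<Sum>x\<in>S. dirichlet h h x)"

lemma gen_eq: "gen h x = (\<Sum>y\<in>nbrs x. c (x, y)) * ((\<Sum>y\<in>nbrs x. jump c x y * h y) - h x)"
proof -
  have "(\<Sum>y\<in>nbrs x. c (x, y)) * (\<Sum>y\<in>nbrs x. jump c x y * h y) = (\<Sum>y\<in>nbrs x. c (x, y) * h y)"
    unfolding sum_distrib_left jump_def using total_pos[of x]
    by (intro sum.cong) (auto simp: arcs_nbrs arcs_iff_nbrs)
  then show ?thesis
    unfolding gen_def right_diff_distrib sum_subtractf by (simp add: sum_distrib_right)
qed

text \<open>The pairing with \<open>F\<close> is at most 3/2 of the cost plus half of the energy of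
  \<open>h\<close>, and this energy is the left-hand side; absorbing it doubles 3/2 to 3.
  \<open>B\<close> is kept apart from \<open>A\<close> because \<open>g\<close> may extend beyond
  the support of \<open>F\<close>.\<close>

lemma capacity_le:
  assumes A: "finite A" "x0 \<in> A" and F: "\<And>x. x \<notin> A \<Longrightarrow> F x = 0" and h: "\<And>x. x \<notin> A \<Longrightarrow> h x = 0"
    and one: "F x0 = 1" "h x0 = 1"
    and harmonic: "\<And>x. x \<in> A \<Longrightarrow> x \<noteq> x0 \<Longrightarrow> gen h x = 0"
    and g: "\<And>x. \<bar>F (x + (1, 0)) - F x\<bar> \<le> g x" "\<And>x. \<bar>F (x + (0, 1)) - F x\<bar> \<le> g x"
      "\<And>x. \<bar>F x - F (x + (1, 1))\<bar> \<le> g x" "\<And>x. \<bar>F (x + (1, 0)) - F (x + (0, 1))\<bar> \<le> g x"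
    and B: "finite B" "\<And>x. x \<notin> B \<Longrightarrow> g x = 0"
  shows "- gen h x0 \<le> 3 * (\<Sum>x\<in>B. (g x)\<^sup>2 * face_cost cs W x)"
proof -
  define S where "S = nbhd (A \<union> B)"
  have S: "finite S" "nbhd A \<subseteq> S" and AS: "A \<subseteq> S" and BS: "B \<subseteq> S"
    using finite_nbhd[of "A \<union> B"] A(1) B(1) by (auto simp: S_def nbhd_def)
  have test: "- (\<Sum>x\<in>S. f x * gen h x) = - gen h x0"
    if "\<And>x. x \<notin> A \<Longrightarrow> f x = 0" "f x0 = 1" for f
  proof -
    have "(\<Sum>x\<in>S. f x * gen h x) = (\<Sum>x\<in>{x0}. f x * gen h x)"
    proof (rule sum.mono_neutral_right[OF S(1)])
      show "{x0} \<subseteq> S" using A AS by blast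
      show "\<forall>x\<in>S - {x0}. f x * gen h x = 0"
        using that(1) harmonic by (metis DiffD2 insertI1 mult_eq_0_iff)
    qed
    then show ?thesis using that(2) by simp
  qed
  have "twist h h x = 0" for x by (simp add: twist_def algebra_simps)
  then have self: "energy h S = - gen h x0"
    using gen_form[of A h h S, OF A(1) h h S] test[of h, OF h one(2)] by (simp add: energy_def)
  define e1 where "e1 x = s1 x * (h (x + (1, 0)) - h x)\<^sup>2" for x
  define e2 where "e2 x = s2 x * (h (x + (0, 1)) - h x)\<^sup>2" for x
  have en: "energy h S = (\<Sum>x\<in>S. e1 x) + (\<Sum>x\<in>S. e2 x)"
    by (simp add: energy_def dirichlet_def e1_def e2_def sum.distrib power2_eq_square mult.assoc)
  \<comment> \<open>The right side of the square at \<open>x\<close> is the left side of the next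
    square, so that the shares 1/3 and 1/6 of the vertical edges combine to 1/2.\<close>
  have shift: "(\<Sum>x\<in>S. e2 (x + (1, 0))) = (\<Sum>x\<in>S. e2 x)"
  proof -
    have "x \<in> S \<and> x - (1, 0) \<in> S" if "e2 x \<noteq> 0" for x
    proof -
      have "x \<in> A \<or> x + (0, 1) \<in> A"
        using that h[of x] h[of "x + (0, 1)"] unfolding e2_def by fastforce
      from this show ?thesis
        by - (erule disjE; intro conjI; intro subsetD[OF S(2)]; erule nbhd_memI; simp)
    qed
    then have "(\<Sum>x\<in>S. e2 (x - (- (1, 0)))) = (\<Sum>x\<in>S. e2 x)"
      by (intro sum_shift[OF S(1)]) auto
    then show ?thesis by (simp only: diff_minus_eq_add)
  qed
  have "- gen h x0 = (\<Sum>x\<in>S. dirichlet F h x - W x * twist F h x)"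
    using gen_form[of A F h S, OF A(1) F h S] test[of F, OF F one(1)] by simp
  also have "\<dots> \<le> (\<Sum>x\<in>S. 3 / 2 * ((g x)\<^sup>2 * face_cost cs W x) +
      (1 / 2 * e1 x + 1 / 3 * e2 x + 1 / 6 * e2 (x + (1, 0))))"
    unfolding e1_def e2_def by (intro sum_mono form_le g)
  also have "\<dots> = 3 / 2 * (\<Sum>x\<in>S. (g x)\<^sup>2 * face_cost cs W x) + 1 / 2 * energy h S"
    unfolding en sum.distrib sum_distrib_left[symmetric] shift by simp
  also have "(\<Sum>x\<in>S. (g x)\<^sup>2 * face_cost cs W x) = (\<Sum>x\<in>B. (g x)\<^sup>2 * face_cost cs W x)"
    using B(2) by (intro sum.mono_neutral_right S BS) auto
  finally show ?thesis unfolding self by linarith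
qed

end

text \<open>Probability of reaching \<open>x\<close> from \<open>y\<close> within \<open>n\<close>
  steps without leaving \<open>A\<close>. The increasing limit provides the harmonic function
  without solving a linear system.\<close>

primrec hit :: "(arc \<Rightarrow> real) \<Rightarrow> pt \<Rightarrow> pt set \<Rightarrow> nat \<Rightarrow> pt \<Rightarrow> real" where
  "hit c x A 0 y = of_bool (y = x)"
| "hit c x A (Suc n) y =
     (if y = x then 1 else if y \<in> A then \<Sum>z\<in>nbrs y. jump c y z * hit c x A n z else 0)"

section \<open>Hitting and avoidance probabilities in a fixed environment\<close>

context curl_conductances begin

lemma jump_c_nonneg: "0 \<le> jump c x y"
  by (rule jump_nonneg) (rule c_nonneg)

lemma sum_jump_c: "(\<Sum>y\<in>nbrs x. jump c x y) = 1"
  by (rule sum_jump[OF total_pos])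

lemma avoid_bounds: "0 \<le> avoid c x n y \<and> avoid c x n y \<le> 1"
proof (induction n arbitrary: y)
  case (Suc n)
  have "(\<Sum>z\<in>nbrs y. jump c y z * (if z = x then 0 else avoid c x n z)) \<le> (\<Sum>z\<in>nbrs y. jump c y z * 1)"
    using Suc by (intro sum_mono mult_left_mono jump_c_nonneg) auto
  then show ?case
    using Suc by (auto simp: sum_jump_c intro!: sum_nonneg mult_nonneg_nonneg jump_c_nonneg)
qed simp

text \<open>Reaching \<open>x\<close> within \<open>n\<close> steps and avoiding it for
  \<open>n\<close> steps exclude each other. The case distinction reflects that \<open>avoid\<close>
  ignores time 0, which \<open>hit\<close> counts.\<close>

lemma hit_le_avoid: "hit c x A n y \<le> 1 - (if y = x then 0 else avoid c x n y)"
proof (induction n arbitrary: y)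
  case (Suc n)
  have "(\<Sum>z\<in>nbrs y. jump c y z * hit c x A n z) \<le>
      (\<Sum>z\<in>nbrs y. jump c y z * (1 - (if z = x then 0 else avoid c x n z)))"
    by (intro sum_mono mult_left_mono jump_c_nonneg Suc)
  also have "\<dots> = 1 - avoid c x (Suc n) y"
    by (simp add: right_diff_distrib sum_subtractf sum_jump_c)
  finally show ?case
    using avoid_bounds[of x "Suc n" y] by (auto simp del: avoid.simps)
qed simp

lemma sum_hit_le_avoid: "(\<Sum>z\<in>nbrs y. jump c y z * hit c x A n z) \<le> 1 - avoid c x (Suc n) y"
proof -
  have "(\<Sum>z\<in>nbrs y. jump c y z * hit c x A n z) \<le>
      (\<Sum>z\<in>nbrs y. jump c y z * (1 - (if z = x then 0 else avoid c x n z)))"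
    by (intro sum_mono mult_left_mono jump_c_nonneg hit_le_avoid)
  then show ?thesis by (simp add: right_diff_distrib sum_subtractf sum_jump_c)
qed

lemma hit_le_1: "hit c x A n y \<le> 1"
  using hit_le_avoid[of x A n y] avoid_bounds[of x n y] by (auto split: if_splits)

lemma hit_mono: "hit c x A n y \<le> hit c x A (Suc n) y"
proof (induction n arbitrary: y)
  case 0
  then show ?case by (auto intro!: sum_nonneg mult_nonneg_nonneg jump_c_nonneg)
next
  case (Suc n)
  have "(\<Sum>z\<in>nbrs y. jump c y z * hit c x A n z) \<le> (\<Sum>z\<in>nbrs y. jump c y z * hit c x A (Suc n) z)"
    by (intro sum_mono mult_left_mono jump_c_nonneg Suc)
  then show ?case by (simp only: hit.simps split: if_split) simp
qed

text \<open>The limit of \<open>hit\<close> inherits the harmonic equations, the sums over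
  neighbours being finite. For it, \<open>- gen h x0\<close> is the total conductance at
  \<open>x0\<close> times the probability of failing to return along a path inside \<open>A\<close>;
  hence the factor in \<open>small\<close>. The strict inequality persists at some finite
  \<open>n\<close>.\<close>

lemma avoid_small:
  assumes A: "finite A" "x0 \<in> A" and F: "\<And>x. x \<notin> A \<Longrightarrow> F x = 0" "F x0 = 1"
    and g: "\<And>x. \<bar>F (x + (1, 0)) - F x\<bar> \<le> g x" "\<And>x. \<bar>F (x + (0, 1)) - F x\<bar> \<le> g x"
      "\<And>x. \<bar>F x - F (x + (1, 1))\<bar> \<le> g x" "\<And>x. \<bar>F (x + (1, 0)) - F (x + (0, 1))\<bar> \<le> g x"
    and B: "finite B" "\<And>x. x \<notin> B \<Longrightarrow> g x = 0"
    and small: "3 * (\<Sum>x\<in>B. (g x)\<^sup>2 * face_cost cs W x) < \<epsilon> * (\<Sum>y\<in>nbrs x0. c (x0, y))"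
  shows "\<exists>m. avoid c x0 m x0 < \<epsilon>"
proof -
  define h where "h y = (SUP n. hit c x0 A n y)" for y
  have lim: "(\<lambda>n. hit c x0 A n y) \<longlonglongrightarrow> h y" for y
    unfolding h_def
    by (intro LIMSEQ_incseq_SUP incseq_SucI hit_mono bdd_aboveI2[where M = 1] hit_le_1)
  have lim_sum: "(\<lambda>n. \<Sum>z\<in>nbrs y. jump c y z * hit c x0 A n z) \<longlonglongrightarrow> (\<Sum>z\<in>nbrs y. jump c y z * h z)" for y
    by (intro tendsto_intros lim)
  have h: "h y = (if y = x0 then 1 else if y \<in> A then \<Sum>z\<in>nbrs y. jump c y z * h z else 0)" for y
  proof (rule LIMSEQ_unique)
    show "(\<lambda>n. hit c x0 A (Suc n) y) \<longlonglongrightarrow> h y" by (rule LIMSEQ_Suc[OF lim])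
    show "(\<lambda>n. hit c x0 A (Suc n) y) \<longlonglongrightarrow>
        (if y = x0 then 1 else if y \<in> A then \<Sum>z\<in>nbrs y. jump c y z * h z else 0)"
      using lim_sum[of y] by auto
  qed
  have hA: "h x = 0" if "x \<notin> A" for x using h[of x] that A(2) by auto
  have h1: "h x0 = 1" using h[of x0] by simp
  have harm: "gen h x = 0" if "x \<in> A" "x \<noteq> x0" for x
    using h[of x] that unfolding gen_eq by simp
  have "- gen h x0 \<le> 3 * (\<Sum>x\<in>B. (g x)\<^sup>2 * face_cost cs W x)"
    by (rule capacity_le[OF A F(1) hA F(2) h1 harm g B])
  also note small
  finally have "(\<Sum>y\<in>nbrs x0. c (x0, y)) * (1 - (\<Sum>y\<in>nbrs x0. jump c x0 y * h y)) <
      (\<Sum>y\<in>nbrs x0. c (x0, y)) * \<epsilon>"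
    unfolding gen_eq h1 by (simp add: algebra_simps)
  then have "1 - \<epsilon> < (\<Sum>y\<in>nbrs x0. jump c x0 y * h y)"
    using total_pos[of x0] by simp
  from order_tendstoD(1)[OF lim_sum this] obtain n
    where "1 - \<epsilon> < (\<Sum>z\<in>nbrs x0. jump c x0 z * hit c x0 A n z)"
    by (auto simp: eventually_sequentially)
  then have "avoid c x0 (Suc n) x0 < \<epsilon>" using sum_hit_le_avoid[of x0 x0 A n] by linarith
  then show ?thesis by blast
qed

end

section \<open>The logarithmic cutoff\<close>

definition sup_norm :: "pt \<Rightarrow> nat" where
  "sup_norm x = nat (max \<bar>fst x\<bar> \<bar>snd x\<bar>)"

lemma sup_norm_zero [simp]: "sup_norm 0 = 0"
  by (simp add: sup_norm_def)

lemma int_sup_norm: "int (sup_norm x) = max \<bar>fst x\<bar> \<bar>snd x\<bar>"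
  by (simp add: sup_norm_def)

lemma sup_norm_lipschitz:
  "\<bar>int (sup_norm x) - int (sup_norm y)\<bar> \<le> max \<bar>fst x - fst y\<bar> \<bar>snd x - snd y\<bar>"
proof -
  have max: "\<bar>max a b - max c d\<bar> \<le> e" if "\<bar>a - c\<bar> \<le> e" "\<bar>b - d\<bar> \<le> e" for a b c d e :: int
    using that by linarith
  show ?thesis
    unfolding int_sup_norm by (intro max order_trans[OF abs_triangle_ineq3 max.cobounded1]
        order_trans[OF abs_triangle_ineq3 max.cobounded2])
qed

text \<open>Harmonic numbers stand in for the logarithm: before truncation the increment between the
  layers \<open>k\<close> and \<open>Suc k\<close> is exactly \<open>1 / Suc k\<close> over
  \<open>harm R\<close>.\<close>

definition log_cutoff :: "nat \<Rightarrow> pt \<Rightarrow> real" where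
  "log_cutoff R x = max 0 (1 - harm (sup_norm x) / harm R)"

text \<open>\<open>Suc\<close> keeps the denominator positive at the origin, and the factor 2 pays
  for corners of the square that lie in the next lower layer.\<close>

definition log_slope :: "nat \<Rightarrow> pt \<Rightarrow> real" where
  "log_slope R x = (if sup_norm x \<le> Suc R then 2 / (real (Suc (sup_norm x)) * harm R) else 0)"

lemma log_cutoff_0: "log_cutoff R 0 = 1"
  by (simp add: log_cutoff_def harm_def)

lemma log_cutoff_eq_0:
  assumes "0 < R" "R \<le> sup_norm x"
  shows "log_cutoff R x = 0"
proof -
  have "1 \<le> harm (sup_norm x) / (harm R :: real)"
    using harm_pos[OF assms(1), where 'a = real] harm_mono[OF assms(2), where 'a = real]
    by (simp only: pos_le_divide_eq mult_1)
  then show ?thesis by (simp add: log_cutoff_def)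
qed

lemma log_cutoff_diff:
  assumes R: "0 < R" and k: "sup_norm y = k \<or> sup_norm y = Suc k" "sup_norm z = k \<or> sup_norm z = Suc k"
    and l: "l \<le> Suc k"
  shows "\<bar>log_cutoff R y - log_cutoff R z\<bar> \<le> 2 / (real (Suc l) * harm R)"
proof -
  let ?f = "\<lambda>n. max 0 (1 - harm n / harm R :: real)"
  have h: "0 < (harm R :: real)" by (rule harm_pos[OF R])
  have "(1 - harm k / harm R) - (1 - harm (Suc k) / harm R) = (1 / real (Suc k)) / (harm R :: real)"
    by (simp add: harm_Suc inverse_eq_divide add_divide_distrib)
  moreover have "0 \<le> (1 / real (Suc k)) / (harm R :: real)" by (intro divide_nonneg_nonneg less_imp_le[OF h]) simp_all
  ultimately have "\<bar>?f k - ?f (Suc k)\<bar> \<le> (1 / real (Suc k)) / harm R" by linarith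
  also have "\<dots> \<le> (2 / real (Suc l)) / harm R"
    by (rule divide_right_mono[OF _ less_imp_le[OF h]]) (use l in \<open>simp add: field_simps\<close>)
  finally have "\<bar>?f k - ?f (Suc k)\<bar> \<le> 2 / (real (Suc l) * harm R)" by simp
  moreover have "0 \<le> 2 / (real (Suc l) * harm R)"
    by (intro divide_nonneg_nonneg mult_nonneg_nonneg less_imp_le[OF h]) simp_all
  ultimately show ?thesis
    using k unfolding log_cutoff_def by (elim disjE) (simp_all add: abs_minus_commute)
qed

text \<open>In the sup norm diagonal neighbours also differ by at most one layer, so one bound
  covers the sides and both diagonals of a square.\<close>

lemma log_cutoff_slope:
  assumes R: "0 < R"
  shows "\<bar>log_cutoff R (x + (1, 0)) - log_cutoff R x\<bar> \<le> log_slope R x"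
    and "\<bar>log_cutoff R (x + (0, 1)) - log_cutoff R x\<bar> \<le> log_slope R x"
    and "\<bar>log_cutoff R x - log_cutoff R (x + (1, 1))\<bar> \<le> log_slope R x"
    and "\<bar>log_cutoff R (x + (1, 0)) - log_cutoff R (x + (0, 1))\<bar> \<le> log_slope R x"
proof -
  define m where "m = sup_norm x"
  have adj: "\<bar>int (sup_norm (x + d)) - int (sup_norm (x + d'))\<bar> \<le> 1"
    if "d \<in> {0, (1, 0), (0, 1), (1, 1)}" "d' \<in> {0, (1, 0), (0, 1), (1, 1)}" for d d'
  proof -
    have "\<bar>fst (x + d) - fst (x + d')\<bar> \<le> 1" "\<bar>snd (x + d) - snd (x + d')\<bar> \<le> 1"
      using that by auto
    then show ?thesis using sup_norm_lipschitz[of "x + d" "x + d'"] by linarith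
  qed
  have near: "m \<le> Suc (sup_norm (x + d)) \<and> sup_norm (x + d) \<le> Suc m"
    if "d \<in> {0, (1, 0), (0, 1), (1, 1)}" for d
    using adj[OF that, of 0] by (simp add: m_def) linarith
  have main: "\<bar>log_cutoff R (x + d) - log_cutoff R (x + d')\<bar> \<le> log_slope R x"
    if dd: "(d, d') \<in> {((1, 0), 0), ((0, 1), 0), (0, (1, 1)), ((1, 0), (0, 1))}" for d d'
  proof (cases "m \<le> Suc R")
    case True
    define k where "k = min (sup_norm (x + d)) (sup_norm (x + d'))"
    have "sup_norm (x + d) = k \<or> sup_norm (x + d) = Suc k" "sup_norm (x + d') = k \<or> sup_norm (x + d') = Suc k"
      using adj[of d d'] dd unfolding k_def by (auto simp: min_def)
    moreover have "m \<le> Suc k"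
      using near[of d] near[of d'] dd unfolding k_def by auto
    ultimately show ?thesis
      using log_cutoff_diff[OF R] True unfolding log_slope_def m_def[symmetric] by simp
  next
    case False
    have "R \<le> sup_norm (x + d)" "R \<le> sup_norm (x + d')"
      using near[of d] near[of d'] dd False by auto
    then show ?thesis using False by (simp add: log_cutoff_eq_0[OF R] log_slope_def m_def)
  qed
  show "\<bar>log_cutoff R (x + (1, 0)) - log_cutoff R x\<bar> \<le> log_slope R x"
    "\<bar>log_cutoff R (x + (0, 1)) - log_cutoff R x\<bar> \<le> log_slope R x"
    "\<bar>log_cutoff R x - log_cutoff R (x + (1, 1))\<bar> \<le> log_slope R x"
    "\<bar>log_cutoff R (x + (1, 0)) - log_cutoff R (x + (0, 1))\<bar> \<le> log_slope R x"
    using main[of "(1, 0)" 0] main[of "(0, 1)" 0] main[of 0 "(1, 1)"] main[of "(1, 0)" "(0, 1)"] by simp_all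
qed

definition sup_ball :: "nat \<Rightarrow> pt set" where
  "sup_ball n = {x. sup_norm x \<le> n}"

lemma finite_sup_ball: "finite (sup_ball n)"
proof (rule finite_subset)
  show "sup_ball n \<subseteq> {- int n..int n} \<times> {- int n..int n}"
  proof
    fix x assume "x \<in> sup_ball n"
    then have "int (sup_norm x) \<le> int n" by (simp add: sup_ball_def)
    then have "\<bar>fst x\<bar> \<le> int n" "\<bar>snd x\<bar> \<le> int n" unfolding int_sup_norm by simp_all
    then show "x \<in> {- int n..int n} \<times> {- int n..int n}" unfolding mem_Times_iff by auto
  qed
qed simp

text \<open>Four sides of \<open>2 * k + 1\<close> points each cover the sphere; linear growth in
  \<open>k\<close> is what the energy estimate uses.\<close>

lemma card_sphere: "card {x. sup_norm x = k} \<le> 8 * Suc k"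
proof -
  let ?I = "{- int k..int k}" and ?E = "{int k, - int k}"
  have "{x. sup_norm x = k} \<subseteq> ?E \<times> ?I \<union> ?I \<times> ?E"
  proof (rule subsetI, unfold mem_Collect_eq)
    fix x assume "sup_norm x = k"
    then have k: "int k = max \<bar>fst x\<bar> \<bar>snd x\<bar>" using int_sup_norm by metis
    then have "\<bar>fst x\<bar> \<le> int k" "\<bar>snd x\<bar> \<le> int k" "\<bar>fst x\<bar> = int k \<or> \<bar>snd x\<bar> = int k"
      by (simp_all add: max_def)
    then have "fst x \<in> ?I" "snd x \<in> ?I" "fst x \<in> ?E \<or> snd x \<in> ?E" by auto
    then show "x \<in> ?E \<times> ?I \<union> ?I \<times> ?E" unfolding Un_iff mem_Times_iff by blast
  qed
  then have "card {x. sup_norm x = k} \<le> card (?E \<times> ?I \<union> ?I \<times> ?E)"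
    by (intro card_mono) auto
  also have "\<dots> \<le> card (?E \<times> ?I) + card (?I \<times> ?E)" by (rule card_Un_le)
  also have "\<dots> = 2 * (card ?E * card ?I)" unfolding card_cartesian_product by algebra
  also have "\<dots> \<le> 2 * (2 * card ?I)"
    by (intro mult_le_mono le_refl) (auto simp: card_insert_if)
  finally show ?thesis by simp
qed

text \<open>Layers of order k with squared slopes of order 1 / k^2 leave a harmonic sum; this is
  where the dimension two enters. The constant is 8 * 2^2, and the two terms beyond
  \<open>harm R\<close> are at most 1 each.\<close>

lemma sum_log_slope_le:
  assumes "0 < R"
  shows "(\<Sum>x\<in>sup_ball (Suc R). (log_slope R x)\<^sup>2) \<le> 32 * (harm R + 2) / (harm R)\<^sup>2"
proof -
  have h: "0 < (harm R :: real)" by (rule harm_pos[OF assms])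
  have "(\<Sum>x\<in>sup_ball (Suc R). (log_slope R x)\<^sup>2) =
      (\<Sum>k\<le>Suc R. \<Sum>x | x \<in> sup_ball (Suc R) \<and> sup_norm x = k. (log_slope R x)\<^sup>2)"
    by (intro sum.group[symmetric] finite_sup_ball) (auto simp: sup_ball_def)
  also have "\<dots> \<le> (\<Sum>k\<le>Suc R. (8 * real (Suc k)) * (2 / (real (Suc k) * harm R))\<^sup>2)"
  proof (rule sum_mono)
    fix k assume "k \<in> {..Suc R}"
    then have "{x. x \<in> sup_ball (Suc R) \<and> sup_norm x = k} = {x. sup_norm x = k}"
      by (auto simp: sup_ball_def)
    then have "(\<Sum>x | x \<in> sup_ball (Suc R) \<and> sup_norm x = k. (log_slope R x)\<^sup>2) =
        (\<Sum>x | sup_norm x = k. (2 / (real (Suc k) * harm R))\<^sup>2)"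
      using \<open>k \<in> _\<close> by (auto intro!: sum.cong simp: log_slope_def)
    also have "\<dots> = real (card {x. sup_norm x = k}) * (2 / (real (Suc k) * harm R))\<^sup>2" by simp
    also have "\<dots> \<le> (8 * real (Suc k)) * (2 / (real (Suc k) * harm R))\<^sup>2"
      using card_sphere[of k] by (intro mult_right_mono zero_le_power2) linarith
    finally show "(\<Sum>x | x \<in> sup_ball (Suc R) \<and> sup_norm x = k. (log_slope R x)\<^sup>2) \<le>
      (8 * real (Suc k)) * (2 / (real (Suc k) * harm R))\<^sup>2" .
  qed
  also have "\<dots> = (\<Sum>k\<le>Suc R. 32 / (harm R)\<^sup>2 * inverse (real (Suc k)))"
    by (intro sum.cong refl) (simp add: power2_eq_square divide_simps)
  also have "\<dots> = 32 / (harm R)\<^sup>2 * harm (Suc (Suc R))"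
  proof -
    have "harm (Suc (Suc R)) = (\<Sum>k\<le>Suc R. inverse (real (Suc k)))"
      unfolding harm_altdef lessThan_Suc_atMost ..
    then show ?thesis by (simp only: sum_distrib_left)
  qed
  also have "\<dots> \<le> 32 / (harm R)\<^sup>2 * (harm R + 2)"
  proof (rule mult_left_mono)
    have "inverse (real (Suc n)) \<le> 1" for n by (simp add: inverse_eq_divide)
    from this[of R] this[of "Suc R"] show "harm (Suc (Suc R)) \<le> (harm R + 2 :: real)"
      by (simp add: harm_Suc)
  qed simp
  finally show ?thesis by simp
qed

lemma log_slope_energy_tendsto_0:
  "(\<lambda>R. \<Sum>x\<in>sup_ball (Suc R). (log_slope R x)\<^sup>2) \<longlonglongrightarrow> 0"
proof (rule tendsto_sandwich)
  show "\<forall>\<^sub>F R in sequentially. 0 \<le> (\<Sum>x\<in>sup_ball (Suc R). (log_slope R x)\<^sup>2)"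
    by (simp add: sum_nonneg)
  show "\<forall>\<^sub>F R in sequentially. (\<Sum>x\<in>sup_ball (Suc R). (log_slope R x)\<^sup>2) \<le> 32 * (harm R + 2) / (harm R)\<^sup>2"
    using eventually_gt_at_top[of 0] by eventually_elim (rule sum_log_slope_le)
  have "((\<lambda>t :: real. 32 * (t + 2) / t\<^sup>2) \<longlongrightarrow> 0) at_top" by real_asymp
  then show "(\<lambda>R. 32 * (harm R + 2) / (harm R)\<^sup>2 :: real) \<longlonglongrightarrow> 0"
    by (rule filterlim_compose) (rule harm_at_top)
qed simp

section \<open>Random conductances\<close>

text \<open>The cutoff is centred at the starting point, which appears as a shift of the face. The
  radius is written as a successor because it must be positive.\<close>

lemma (in curl_conductances) recurrent_walk_if_small_energy:
  assumes small: "\<And>x0 \<epsilon>. 0 < \<epsilon> \<Longrightarrow>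
    \<exists>R. (\<Sum>x\<in>sup_ball (Suc (Suc R)). (log_slope (Suc R) x)\<^sup>2 * face_cost cs W (x + x0)) < \<epsilon>"
  shows "recurrent_walk c"
proof (rule recurrent_walkI[OF c_nonneg total_pos])
  fix x0 :: pt and \<epsilon> :: real assume "0 < \<epsilon>"
  \<comment> \<open>The 3 is the constant of the capacity bound; the total conductance converts an
    escape rate into a probability.\<close>
  then have "0 < \<epsilon> * (\<Sum>y\<in>nbrs x0. c (x0, y)) / 3" using total_pos[of x0] by simp
  from small[OF this, of x0] obtain R'
    where R': "(\<Sum>x\<in>sup_ball (Suc (Suc R')). (log_slope (Suc R') x)\<^sup>2 * face_cost cs W (x + x0)) <
      \<epsilon> * (\<Sum>y\<in>nbrs x0. c (x0, y)) / 3" by blast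
  define R where "R = Suc R'"
  have R: "0 < R" by (simp add: R_def)
  have shift: "x + d - x0 = x - x0 + d" for x d :: pt by simp
  show "\<exists>m. avoid c x0 m x0 < \<epsilon>"
  proof (rule avoid_small[where A = "(\<lambda>x. x + x0) ` sup_ball R" and B = "(\<lambda>x. x + x0) ` sup_ball (Suc R)"
        and F = "\<lambda>x. log_cutoff R (x - x0)" and g = "\<lambda>x. log_slope R (x - x0)"])
    show "finite ((\<lambda>x. x + x0) ` sup_ball R)" "finite ((\<lambda>x. x + x0) ` sup_ball (Suc R))"
      by (simp_all add: finite_sup_ball)
    have "0 \<in> sup_ball R" by (simp add: sup_ball_def)
    then show "x0 \<in> (\<lambda>x. x + x0) ` sup_ball R" by (intro image_eqI[of _ _ 0]) simp_all
    show "log_cutoff R (x0 - x0) = 1" by (simp add: log_cutoff_0)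
    have image: "x \<in> (\<lambda>x. x + x0) ` sup_ball n" if "x - x0 \<in> sup_ball n" for x n
      using that by (intro image_eqI[of _ _ "x - x0"]) simp_all
    show "log_cutoff R (x - x0) = 0" if "x \<notin> (\<lambda>x. x + x0) ` sup_ball R" for x
      using image[of x R] that by (intro log_cutoff_eq_0[OF R]) (auto simp: sup_ball_def)
    show "log_slope R (x - x0) = 0" if "x \<notin> (\<lambda>x. x + x0) ` sup_ball (Suc R)" for x
      using image[of x "Suc R"] that by (auto simp: sup_ball_def log_slope_def)
    show "3 * (\<Sum>x\<in>(\<lambda>x. x + x0) ` sup_ball (Suc R). (log_slope R (x - x0))\<^sup>2 * face_cost cs W x) <
        \<epsilon> * (\<Sum>y\<in>nbrs x0. c (x0, y))"
      using R' by (subst sum.reindex) (simp_all add: inj_on_def R_def)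
  qed (simp_all only: shift log_cutoff_slope[OF R])
qed

text \<open>The integral of the infimum is at most every \<open>b n\<close>, hence zero. This
  replaces the choice of a subsequence, and the index may depend on the point. That
  \<open>ennreal\<close> cuts off negative values is harmless for an upper bound.\<close>

lemma AE_small_if_nn_integral_tendsto_0:
  fixes f :: "nat \<Rightarrow> 'w \<Rightarrow> real"
  assumes [measurable]: "\<And>n. f n \<in> borel_measurable M"
    and le: "\<And>n. (\<integral>\<^sup>+\<omega>. ennreal (f n \<omega>) \<partial>M) \<le> ennreal (b n)" and b: "b \<longlonglongrightarrow> 0"
  shows "AE \<omega> in M. \<forall>\<epsilon>>0. \<exists>n. f n \<omega> < \<epsilon>"
proof -
  define g where "g \<omega> = (INF n. ennreal (f n \<omega>))" for \<omega>
  have [measurable]: "g \<in> borel_measurable M" unfolding g_def by measurable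
  have "(\<integral>\<^sup>+\<omega>. g \<omega> \<partial>M) \<le> ennreal (b n)" for n
  proof -
    have "(\<integral>\<^sup>+\<omega>. g \<omega> \<partial>M) \<le> (\<integral>\<^sup>+\<omega>. ennreal (f n \<omega>) \<partial>M)"
      unfolding g_def by (intro nn_integral_mono INF_lower) simp
    also note le
    finally show ?thesis .
  qed
  moreover have "(\<lambda>n. ennreal (b n)) \<longlonglongrightarrow> 0" using tendsto_ennrealI[OF b] by simp
  ultimately have "(\<integral>\<^sup>+\<omega>. g \<omega> \<partial>M) \<le> 0" by (intro LIMSEQ_le_const) auto
  then have "AE \<omega> in M. g \<omega> = 0" by (simp add: nn_integral_0_iff_AE)
  then show ?thesis
  proof (eventually_elim, intro allI impI)
    fix \<omega> and \<epsilon> :: real assume "g \<omega> = 0" "0 < \<epsilon>"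
    then have "g \<omega> < ennreal \<epsilon>" by simp
    then obtain n where n: "ennreal (f n \<omega>) < ennreal \<epsilon>" unfolding g_def INF_less_iff by blast
    have "\<not> \<epsilon> \<le> f n \<omega>"
    proof
      assume "\<epsilon> \<le> f n \<omega>"
      then have "ennreal \<epsilon> \<le> ennreal (f n \<omega>)" by (rule ennreal_leI)
      with n show False by simp
    qed
    then show "\<exists>n. f n \<omega> < \<epsilon>" by (meson not_le)
  qed
qed

text \<open>The infinite sum is \<open>0\<close> where the family is not summable, so it need not be measurable itself.\<close>

lemma infsum_measurable_version:
  fixes f :: "'i \<Rightarrow> 'w \<Rightarrow> real"
  assumes \<Gamma>: "countable \<Gamma>" and f: "\<And>\<gamma>. \<gamma> \<in> \<Gamma> \<Longrightarrow> f \<gamma> \<in> borel_measurable M"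
  shows "\<exists>g\<in>borel_measurable M. \<forall>\<omega>. (\<lambda>\<gamma>. f \<gamma> \<omega>) summable_on \<Gamma> \<longrightarrow> (\<Sum>\<^sub>\<infinity>\<gamma>\<in>\<Gamma>. f \<gamma> \<omega>) = g \<omega>"
proof -
  let ?N = "to_nat_on \<Gamma> ` \<Gamma>"
  define F where "F n \<omega> = (if n \<in> ?N then f (from_nat_into \<Gamma> n) \<omega> else 0)" for n \<omega>
  have "F n \<in> borel_measurable M" for n
    using f \<Gamma> by (cases "n \<in> ?N") (auto simp: F_def[abs_def])
  then have "(\<lambda>\<omega>. \<Sum>n. F n \<omega>) \<in> borel_measurable M" by (rule borel_measurable_suminf)
  moreover have "(\<Sum>\<^sub>\<infinity>\<gamma>\<in>\<Gamma>. f \<gamma> \<omega>) = (\<Sum>n. F n \<omega>)" if "(\<lambda>\<gamma>. f \<gamma> \<omega>) summable_on \<Gamma>" for \<omega>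
  proof -
    have "((\<lambda>\<gamma>. f \<gamma> \<omega>) has_sum (\<Sum>\<^sub>\<infinity>\<gamma>\<in>\<Gamma>. f \<gamma> \<omega>)) \<Gamma>" using that by (rule has_sum_infsum)
    also have "?this \<longleftrightarrow> (((\<lambda>n. F n \<omega>) \<circ> to_nat_on \<Gamma>) has_sum (\<Sum>\<^sub>\<infinity>\<gamma>\<in>\<Gamma>. f \<gamma> \<omega>)) \<Gamma>"
      using \<Gamma> by (intro has_sum_cong) (simp add: F_def)
    also have "\<dots> \<longleftrightarrow> ((\<lambda>n. F n \<omega>) has_sum (\<Sum>\<^sub>\<infinity>\<gamma>\<in>\<Gamma>. f \<gamma> \<omega>)) ?N"
      by (rule has_sum_reindex[symmetric]) (rule inj_on_to_nat_on[OF \<Gamma>])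
    also have "\<dots> \<longleftrightarrow> ((\<lambda>n. F n \<omega>) has_sum (\<Sum>\<^sub>\<infinity>\<gamma>\<in>\<Gamma>. f \<gamma> \<omega>)) UNIV"
      by (rule has_sum_cong_neutral) (auto simp: F_def)
    finally have "(\<lambda>n. F n \<omega>) sums (\<Sum>\<^sub>\<infinity>\<gamma>\<in>\<Gamma>. f \<gamma> \<omega>)" by (rule has_sum_imp_sums)
    then show ?thesis by (rule sums_unique)
  qed
  ultimately show ?thesis by (intro bexI[of _ "\<lambda>\<omega>. \<Sum>n. F n \<omega>"] allI impI)
qed

text \<open>Tonelli over a countable index set: a nonnegative series with finite expectation
  converges almost surely.\<close>

lemma AE_summable_if_nn_integral_finite:
  fixes f :: "'i \<Rightarrow> 'w \<Rightarrow> real"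
  assumes \<Gamma>: "countable \<Gamma>" and f: "\<And>\<gamma>. \<gamma> \<in> \<Gamma> \<Longrightarrow> f \<gamma> \<in> borel_measurable M"
    and nn: "AE \<omega> in M. \<forall>\<gamma>\<in>\<Gamma>. 0 \<le> f \<gamma> \<omega>"
    and fin: "(\<integral>\<^sup>+\<gamma>. (\<integral>\<^sup>+\<omega>. ennreal (f \<gamma> \<omega>) \<partial>M) \<partial>count_space \<Gamma>) < \<infinity>"
  shows "AE \<omega> in M. (\<lambda>\<gamma>. f \<gamma> \<omega>) summable_on \<Gamma>"
proof -
  interpret sigma_finite_measure "count_space \<Gamma>"
    using \<Gamma> by (rule sigma_finite_measure_count_space_countable)
  have "(\<lambda>(\<gamma>, \<omega>). ennreal (f \<gamma> \<omega>)) \<in> borel_measurable (count_space \<Gamma> \<Otimes>\<^sub>M M)"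
    using f by (intro measurable_pair_measure_countable1 \<Gamma>) auto
  then have "(\<lambda>(\<omega>, \<gamma>). ennreal (f \<gamma> \<omega>)) \<in> borel_measurable (M \<Otimes>\<^sub>M count_space \<Gamma>)"
    by (subst measurable_pair_swap_iff) (simp add: case_prod_unfold)
  then have meas: "(\<lambda>\<omega>. \<integral>\<^sup>+\<gamma>. ennreal (f \<gamma> \<omega>) \<partial>count_space \<Gamma>) \<in> borel_measurable M"
    by (rule borel_measurable_nn_integral)
  have "(\<integral>\<^sup>+\<omega>. (\<integral>\<^sup>+\<gamma>. ennreal (f \<gamma> \<omega>) \<partial>count_space \<Gamma>) \<partial>M) \<noteq> \<infinity>"
    using fin f by (subst nn_integral_count_space_nn_integral[OF \<Gamma>]) auto
  from nn_integral_noteq_infinite[OF meas this] nn show ?thesis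
  proof eventually_elim
    case (elim \<omega>)
    have "integrable (count_space \<Gamma>) (\<lambda>\<gamma>. f \<gamma> \<omega>)"
      using elim by (intro integrableI_nonneg) (auto simp: AE_count_space less_top)
    then have "Infinite_Set_Sum.abs_summable_on (\<lambda>\<gamma>. f \<gamma> \<omega>) \<Gamma>"
      unfolding Infinite_Set_Sum.abs_summable_on_def .
    then show ?case
      by (rule summable_on_iff_abs_summable_on_real[THEN iffD2, OF abs_summable_equivalent[THEN iffD2]])
  qed
qed

section \<open>The asymmetric conductances as a random curl\<close>

lemma abs_flow_swap: "\<bar>flow \<gamma> (y, x)\<bar> = \<bar>flow \<gamma> (x, y)\<bar>"
  by (subst flow_swap) simp

lemma cond_asym_swap: "cond_asym \<Gamma> Z (y, x) \<omega> = - cond_asym \<Gamma> Z (x, y) \<omega>"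
  unfolding cond_asym_def by (subst flow_swap) (simp add: infsum_uminus)

lemma cond_abs_swap: "cond_abs \<Gamma> Z (y, x) \<omega> = cond_abs \<Gamma> Z (x, y) \<omega>"
  unfolding cond_abs_def by (subst abs_flow_swap) (rule refl)

lemma abs_cond_asym_le:
  assumes nn: "\<And>\<gamma>. \<gamma> \<in> \<Gamma> \<Longrightarrow> 0 \<le> Z \<gamma> \<omega>"
    and sm: "(\<lambda>\<gamma>. Z \<gamma> \<omega> * \<bar>flow \<gamma> a\<bar>) summable_on \<Gamma>"
  shows "\<bar>cond_asym \<Gamma> Z a \<omega>\<bar> \<le> cond_abs \<Gamma> Z a \<omega>"
proof -
  have eq: "norm (Z \<gamma> \<omega> * flow \<gamma> a) = Z \<gamma> \<omega> * \<bar>flow \<gamma> a\<bar>" if "\<gamma> \<in> \<Gamma>" for \<gamma>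
    using nn[OF that] by (simp add: abs_mult)
  have "(\<lambda>\<gamma>. norm (Z \<gamma> \<omega> * flow \<gamma> a)) summable_on \<Gamma>"
    using sm by (subst summable_on_cong[OF eq])
  then have "norm (\<Sum>\<^sub>\<infinity>\<gamma>\<in>\<Gamma>. Z \<gamma> \<omega> * flow \<gamma> a) \<le> (\<Sum>\<^sub>\<infinity>\<gamma>\<in>\<Gamma>. norm (Z \<gamma> \<omega> * flow \<gamma> a))"
    by (rule norm_infsum_bound)
  also have "\<dots> = cond_abs \<Gamma> Z a \<omega>" unfolding cond_abs_def by (rule infsum_cong[OF eq])
  finally show ?thesis by (simp add: cond_asym_def)
qed

lemma summable_weighted:
  fixes f :: "'i \<Rightarrow> real"
  assumes nn: "\<And>\<gamma>. \<gamma> \<in> \<Gamma> \<Longrightarrow> 0 \<le> z \<gamma>" and sm: "(\<lambda>\<gamma>. z \<gamma> * \<bar>f \<gamma>\<bar>) summable_on \<Gamma>"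
  shows "(\<lambda>\<gamma>. z \<gamma> * f \<gamma>) summable_on \<Gamma>"
proof -
  have "norm (z \<gamma> * f \<gamma>) = z \<gamma> * \<bar>f \<gamma>\<bar>" if "\<gamma> \<in> \<Gamma>" for \<gamma>
    using nn[OF that] by (simp add: abs_mult)
  then have "(\<lambda>\<gamma>. norm (z \<gamma> * f \<gamma>)) summable_on \<Gamma>"
    using sm by (subst summable_on_cong)
  then show ?thesis by (rule summable_on_iff_abs_summable_on_real[THEN iffD2])
qed

text \<open>The curl identity holds cycle by cycle and passes to the random sum because both face
  series converge.\<close>

lemma cond_asym_eq_face_total:
  assumes cyc: "\<And>\<gamma>. \<gamma> \<in> \<Gamma> \<Longrightarrow> is_cycle \<gamma>"
    and nn: "\<And>\<gamma>. \<gamma> \<in> \<Gamma> \<Longrightarrow> 0 \<le> Z \<gamma> \<omega>"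
    and sm: "\<And>x. (\<lambda>\<gamma>. Z \<gamma> \<omega> * \<bar>face_weight \<gamma> x\<bar>) summable_on \<Gamma>"
    and a: "a \<in> arcs"
  shows "cond_asym \<Gamma> Z a \<omega> = face_total \<Gamma> Z (face_pos a) \<omega> - face_total \<Gamma> Z (face_neg a) \<omega>"
proof -
  have s: "(\<lambda>\<gamma>. Z \<gamma> \<omega> * face_weight \<gamma> x) summable_on \<Gamma>" for x
    using nn sm by (rule summable_weighted)
  have "cond_asym \<Gamma> Z a \<omega> =
      (\<Sum>\<^sub>\<infinity>\<gamma>\<in>\<Gamma>. Z \<gamma> \<omega> * face_weight \<gamma> (face_pos a) - Z \<gamma> \<omega> * face_weight \<gamma> (face_neg a))"
    unfolding cond_asym_def
    by (intro infsum_cong) (simp add: flow_eq_face_weight[OF cyc a] right_diff_distrib)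
  also have "\<dots> = face_total \<Gamma> Z (face_pos a) \<omega> - face_total \<Gamma> Z (face_neg a) \<omega>"
    unfolding face_total_def diff_conv_add_uminus infsum_uminus[symmetric]
    by (intro infsum_add s summable_on_uminus[THEN iffD2])
  finally show ?thesis .
qed

text \<open>The integrand of the moment condition.\<close>

definition arc_cost :: "(arc \<Rightarrow> real) \<Rightarrow> (pt \<Rightarrow> real) \<Rightarrow> arc \<Rightarrow> real" where
  "arc_cost s W a = s a + ((W (face_pos a))\<^sup>2 + (W (face_neg a))\<^sup>2) / s a"

text \<open>The face \<open>x\<close> is the left face of the bottom and the right-hand arc and the
  right face of the left-hand arc, so each of the three integrands contains its square. The terms of
  the other faces are nonnegative and are dropped.\<close>

lemma face_cost_le_arc_cost:
  assumes pos: "\<And>a. a \<in> arcs \<Longrightarrow> 0 < s a"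
  shows "face_cost s W x \<le> 2 * arc_cost s W (x, x + (1, 0)) + arc_cost s W (x, x + (0, 1)) +
    arc_cost s W (x + (1, 0), x + (1, 0) + (0, 1))"
proof -
  have p: "0 < s (x, x + (1, 0))" "0 < s (x, x + (0, 1))" "0 < s (x + (1, 0), x + (1, 0) + (0, 1))"
    by (auto intro!: pos simp: arcs_iff)
  have "face_pos (x + (1, 0), x + (1, 0) + (0, 1)) = x" using face_pos_up[of "x + (1, 0)"] by simp
  then have "2 * arc_cost s W (x, x + (1, 0)) + arc_cost s W (x, x + (0, 1)) +
      arc_cost s W (x + (1, 0), x + (1, 0) + (0, 1)) - face_cost s W x =
    s (x, x + (1, 0)) + s (x + (1, 0), x + (1, 0) + (0, 1)) +
    2 * ((W (x - (0, 1)))\<^sup>2 / s (x, x + (1, 0))) + (W (x - (1, 0)))\<^sup>2 / s (x, x + (0, 1)) +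
    (W (face_neg (x + (1, 0), x + (1, 0) + (0, 1))))\<^sup>2 / s (x + (1, 0), x + (1, 0) + (0, 1))"
    unfolding arc_cost_def face_cost_def
    by (simp only: face_pos_right face_neg_right face_pos_up[of x] face_neg_up[of x] add_divide_distrib distrib_left)
       (simp add: field_simps)
  also have "\<dots> \<ge> 0" using p by (intro add_nonneg_nonneg mult_nonneg_nonneg divide_nonneg_pos) auto
  finally show ?thesis by simp
qed

theorem lemma5p5:
  fixes M :: "'w measure"
    and \<Gamma> :: "pt list set"
    and Z :: "pt list \<Rightarrow> 'w \<Rightarrow> real"
    and Y cs :: "arc \<Rightarrow> 'w \<Rightarrow> real"
  assumes "prob_space M"
    and "\<And>\<gamma>. \<gamma> \<in> \<Gamma> \<Longrightarrow> is_cycle \<gamma>"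
    and "\<And>\<gamma>. \<gamma> \<in> \<Gamma> \<Longrightarrow> Z \<gamma> \<in> borel_measurable M"
    and "\<And>\<gamma>. \<gamma> \<in> \<Gamma> \<Longrightarrow> AE \<omega> in M. 0 \<le> Z \<gamma> \<omega>"
    and "\<And>a. a \<in> arcs \<Longrightarrow> AE \<omega> in M. (\<lambda>\<gamma>. Z \<gamma> \<omega> * \<bar>flow \<gamma> a\<bar>) summable_on \<Gamma>"
    and "\<And>x. (\<integral>\<^sup>+\<gamma>. (\<integral>\<^sup>+\<omega>. ennreal (Z \<gamma> \<omega>) \<partial>M) * ennreal \<bar>face_weight \<gamma> x\<bar>
               \<partial>count_space \<Gamma>) < \<infinity>"
    and "\<And>a. a \<in> arcs \<Longrightarrow> Y a \<in> borel_measurable M"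
    and "\<And>a. a \<in> arcs \<Longrightarrow> AE \<omega> in M. 0 \<le> Y a \<omega>"
    and "\<And>x y. (x, y) \<in> arcs \<Longrightarrow> AE \<omega> in M. Y (x, y) \<omega> = Y (y, x) \<omega>"
    and "(\<forall>a\<in>arcs. \<forall>\<omega>\<in>space M. cs a \<omega> = Y a \<omega> + \<bar>cond_asym \<Gamma> Z a \<omega>\<bar>) \<or>
         (\<forall>a\<in>arcs. \<forall>\<omega>\<in>space M. cs a \<omega> = Y a \<omega> + cond_abs \<Gamma> Z a \<omega>)"
    and "\<And>a. a \<in> arcs \<Longrightarrow> AE \<omega> in M. 0 < cs a \<omega>"
    and "AE \<omega> in M. irreducible_walk (\<lambda>a. cs a \<omega> + cond_asym \<Gamma> Z a \<omega>)"
    and "(SUP a\<in>arcs. \<integral>\<^sup>+\<omega>. ennreal (cs a \<omega> +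
            ((face_total \<Gamma> Z (face_pos a) \<omega>)\<^sup>2 + (face_total \<Gamma> Z (face_neg a) \<omega>)\<^sup>2) / cs a \<omega>)
            \<partial>M) < \<infinity>"
  shows "AE \<omega> in M. recurrent_walk (\<lambda>a. cs a \<omega> + cond_asym \<Gamma> Z a \<omega>)"
proof -
  note cyc = assms(2) and Z_meas = assms(3) and Y_meas = assms(7) and cs_eq = assms(10)
  have \<Gamma>: "countable \<Gamma>" by (rule countable_subset[OF subset_UNIV]) simp
  have arcs: "countable arcs" by (rule countable_subset[OF subset_UNIV]) simp

  have Z_times: "(\<lambda>\<omega>. Z \<gamma> \<omega> * r) \<in> borel_measurable M" if "\<gamma> \<in> \<Gamma>" for \<gamma> r
    using Z_meas[OF that] by measurable
  have Z_nn: "AE \<omega> in M. \<forall>\<gamma>\<in>\<Gamma>. 0 \<le> Z \<gamma> \<omega>"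
    using assms(4) by (simp add: AE_ball_countable[OF \<Gamma>])
  have flow_sm: "AE \<omega> in M. \<forall>a\<in>arcs. (\<lambda>\<gamma>. Z \<gamma> \<omega> * \<bar>flow \<gamma> a\<bar>) summable_on \<Gamma>"
    using assms(5) by (simp add: AE_ball_countable[OF arcs])
  have Y_nn: "AE \<omega> in M. \<forall>a\<in>arcs. 0 \<le> Y a \<omega>"
    using assms(8) by (simp add: AE_ball_countable[OF arcs])
  have "AE \<omega> in M. Y a \<omega> = Y (snd a, fst a) \<omega>" if "a \<in> arcs" for a
    using assms(9)[of "fst a" "snd a"] that by simp
  then have Y_sym: "AE \<omega> in M. \<forall>a\<in>arcs. Y a \<omega> = Y (snd a, fst a) \<omega>"
    by (simp add: AE_ball_countable[OF arcs])
  have cs_pos: "AE \<omega> in M. \<forall>a\<in>arcs. 0 < cs a \<omega>"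
    using assms(11) by (simp add: AE_ball_countable[OF arcs])
  have face_sm: "AE \<omega> in M. \<forall>x. (\<lambda>\<gamma>. Z \<gamma> \<omega> * \<bar>face_weight \<gamma> x\<bar>) summable_on \<Gamma>"
    unfolding AE_all_countable
  proof
    fix x
    show "AE \<omega> in M. (\<lambda>\<gamma>. Z \<gamma> \<omega> * \<bar>face_weight \<gamma> x\<bar>) summable_on \<Gamma>"
    proof (rule AE_summable_if_nn_integral_finite[OF \<Gamma>])
      show "(\<lambda>\<omega>. Z \<gamma> \<omega> * \<bar>face_weight \<gamma> x\<bar>) \<in> borel_measurable M" if "\<gamma> \<in> \<Gamma>" for \<gamma>
        using Z_meas[OF that] by measurable
      show "AE \<omega> in M. \<forall>\<gamma>\<in>\<Gamma>. 0 \<le> Z \<gamma> \<omega> * \<bar>face_weight \<gamma> x\<bar>"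
        using Z_nn by eventually_elim simp
      have "(\<integral>\<^sup>+\<omega>. ennreal (Z \<gamma> \<omega> * \<bar>face_weight \<gamma> x\<bar>) \<partial>M) =
          (\<integral>\<^sup>+\<omega>. ennreal (Z \<gamma> \<omega>) \<partial>M) * ennreal \<bar>face_weight \<gamma> x\<bar>" if "\<gamma> \<in> \<Gamma>" for \<gamma>
        using Z_meas[OF that] by (simp add: ennreal_mult'' nn_integral_multc)
      then have "(\<integral>\<^sup>+\<gamma>. (\<integral>\<^sup>+\<omega>. ennreal (Z \<gamma> \<omega> * \<bar>face_weight \<gamma> x\<bar>) \<partial>M) \<partial>count_space \<Gamma>) =
          (\<integral>\<^sup>+\<gamma>. (\<integral>\<^sup>+\<omega>. ennreal (Z \<gamma> \<omega>) \<partial>M) * ennreal \<bar>face_weight \<gamma> x\<bar> \<partial>count_space \<Gamma>)"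
        by (intro nn_integral_cong) simp
      then show "(\<integral>\<^sup>+\<gamma>. (\<integral>\<^sup>+\<omega>. ennreal (Z \<gamma> \<omega> * \<bar>face_weight \<gamma> x\<bar>) \<partial>M) \<partial>count_space \<Gamma>) < \<infinity>"
        using assms(6)[of x] by simp
    qed
  qed

  \<comment> \<open>The random sums are replaced by measurable versions \<open>W\<close> and
    \<open>S\<close>; the moment condition carries over because integrals ignore null sets.\<close>
  have "\<exists>g\<in>borel_measurable M. AE \<omega> in M. face_total \<Gamma> Z x \<omega> = g \<omega>" for x
  proof -
    obtain g where "g \<in> borel_measurable M"
      and g: "\<forall>\<omega>. (\<lambda>\<gamma>. Z \<gamma> \<omega> * face_weight \<gamma> x) summable_on \<Gamma> \<longrightarrow> face_total \<Gamma> Z x \<omega> = g \<omega>"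
      using infsum_measurable_version[OF \<Gamma>, of "\<lambda>\<gamma> \<omega>. Z \<gamma> \<omega> * face_weight \<gamma> x" M, OF Z_times]
      unfolding face_total_def by blast
    moreover have "AE \<omega> in M. face_total \<Gamma> Z x \<omega> = g \<omega>"
      using face_sm Z_nn
    proof eventually_elim
      case (elim \<omega>)
      then have "(\<lambda>\<gamma>. Z \<gamma> \<omega> * face_weight \<gamma> x) summable_on \<Gamma>"
        using summable_weighted[of \<Gamma> "\<lambda>\<gamma>. Z \<gamma> \<omega>" "\<lambda>\<gamma>. face_weight \<gamma> x"] by blast
      then show ?case using g by blast
    qed
    ultimately show ?thesis by blast
  qed
  then obtain W where W_meas: "\<And>x. W x \<in> borel_measurable M"
    and W_eq: "\<And>x. AE \<omega> in M. face_total \<Gamma> Z x \<omega> = W x \<omega>" by metis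

  have ca_eq: "AE \<omega> in M. \<forall>a\<in>arcs. cond_asym \<Gamma> Z a \<omega> =
      face_total \<Gamma> Z (face_pos a) \<omega> - face_total \<Gamma> Z (face_neg a) \<omega>"
    using Z_nn face_sm
    by eventually_elim (intro ballI cond_asym_eq_face_total cyc, auto)

  have "\<exists>g\<in>borel_measurable M. AE \<omega> in M. cs a \<omega> = g \<omega>" if a: "a \<in> arcs" for a
  proof -
    obtain g where g_meas: "g \<in> borel_measurable M"
      and g: "\<forall>\<omega>. (\<lambda>\<gamma>. Z \<gamma> \<omega> * flow \<gamma> a) summable_on \<Gamma> \<longrightarrow> cond_asym \<Gamma> Z a \<omega> = g \<omega>"
      using infsum_measurable_version[OF \<Gamma>, of "\<lambda>\<gamma> \<omega>. Z \<gamma> \<omega> * flow \<gamma> a" M, OF Z_times]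
      unfolding cond_asym_def by blast
    obtain k where k_meas: "k \<in> borel_measurable M"
      and k: "\<forall>\<omega>. (\<lambda>\<gamma>. Z \<gamma> \<omega> * \<bar>flow \<gamma> a\<bar>) summable_on \<Gamma> \<longrightarrow> cond_abs \<Gamma> Z a \<omega> = k \<omega>"
      using infsum_measurable_version[OF \<Gamma>, of "\<lambda>\<gamma> \<omega>. Z \<gamma> \<omega> * \<bar>flow \<gamma> a\<bar>" M, OF Z_times]
      unfolding cond_abs_def by blast
    have sm: "AE \<omega> in M. (\<lambda>\<gamma>. Z \<gamma> \<omega> * \<bar>flow \<gamma> a\<bar>) summable_on \<Gamma> \<and>
        (\<lambda>\<gamma>. Z \<gamma> \<omega> * flow \<gamma> a) summable_on \<Gamma>"
      using Z_nn flow_sm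
    proof eventually_elim
      case (elim \<omega>)
      then show ?case using a summable_weighted[of \<Gamma> "\<lambda>\<gamma>. Z \<gamma> \<omega>" "\<lambda>\<gamma>. flow \<gamma> a"] by blast
    qed
    show ?thesis using cs_eq
    proof
      assume e: "\<forall>a\<in>arcs. \<forall>\<omega>\<in>space M. cs a \<omega> = Y a \<omega> + \<bar>cond_asym \<Gamma> Z a \<omega>\<bar>"
      have "AE \<omega> in M. cs a \<omega> = Y a \<omega> + \<bar>g \<omega>\<bar>"
        using sm AE_space by eventually_elim (use e a g in simp)
      then show ?thesis using Y_meas[OF a] g_meas by (intro bexI[of _ "\<lambda>\<omega>. Y a \<omega> + \<bar>g \<omega>\<bar>"]) auto
    next
      assume e: "\<forall>a\<in>arcs. \<forall>\<omega>\<in>space M. cs a \<omega> = Y a \<omega> + cond_abs \<Gamma> Z a \<omega>"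
      have "AE \<omega> in M. cs a \<omega> = Y a \<omega> + k \<omega>"
        using sm AE_space by eventually_elim (use e a k in simp)
      then show ?thesis using Y_meas[OF a] k_meas by (intro bexI[of _ "\<lambda>\<omega>. Y a \<omega> + k \<omega>"]) auto
    qed
  qed
  then obtain S where S_meas: "\<And>a. a \<in> arcs \<Longrightarrow> S a \<in> borel_measurable M"
    and S_eq: "\<And>a. a \<in> arcs \<Longrightarrow> AE \<omega> in M. cs a \<omega> = S a \<omega>" by metis

  \<comment> \<open>Both choices dominate the asymmetric part: the first through its absolute value,
    the second by the triangle inequality in the sum over cycles.\<close>
  have curl: "AE \<omega> in M. curl_conductances (\<lambda>a. cs a \<omega>) (\<lambda>a. cond_asym \<Gamma> Z a \<omega>)
      (\<lambda>x. face_total \<Gamma> Z x \<omega>)"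
    using Z_nn flow_sm Y_nn Y_sym cs_pos ca_eq AE_space
  proof eventually_elim
    case (elim \<omega>)
    have sum_le: "\<bar>cond_asym \<Gamma> Z a \<omega>\<bar> \<le> cond_abs \<Gamma> Z a \<omega>" if "a \<in> arcs" for a
      using elim(1,2) that by (intro abs_cond_asym_le) auto
    show ?case
    proof
      fix x y :: pt assume xy: "(x, y) \<in> arcs"
      then have yx: "(y, x) \<in> arcs" using arcs_sym by blast
      have "Y (x, y) \<omega> = Y (y, x) \<omega>" using elim(4) xy by fastforce
      then show "cs (x, y) \<omega> = cs (y, x) \<omega>"
        using cs_eq xy yx elim(7) cond_asym_swap[of \<Gamma> Z y x \<omega>] cond_abs_swap[of \<Gamma> Z y x \<omega>] by auto
    next
      fix a assume a: "a \<in> arcs"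
      show "0 < cs a \<omega>" using elim(5) a by blast
      show "cond_asym \<Gamma> Z a \<omega> = face_total \<Gamma> Z (face_pos a) \<omega> - face_total \<Gamma> Z (face_neg a) \<omega>"
        using elim(6) a by blast
      have "0 \<le> Y a \<omega>" using elim(3) a by blast
      then show "\<bar>cond_asym \<Gamma> Z a \<omega>\<bar> \<le> cs a \<omega>"
        using cs_eq a elim(7) sum_le[OF a] by fastforce
    qed
  qed

  obtain k where k: "0 \<le> k" "(SUP a\<in>arcs. \<integral>\<^sup>+\<omega>. ennreal (cs a \<omega> +
      ((face_total \<Gamma> Z (face_pos a) \<omega>)\<^sup>2 + (face_total \<Gamma> Z (face_neg a) \<omega>)\<^sup>2) / cs a \<omega>) \<partial>M) = ennreal k"
    using assms(13) by (auto simp: less_top_ennreal)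
  define cost where "cost a \<omega> = arc_cost (\<lambda>a. S a \<omega>) (\<lambda>x. W x \<omega>) a" for a \<omega>
  have cost_meas [measurable]: "cost a \<in> borel_measurable M" if "a \<in> arcs" for a
    unfolding cost_def[abs_def] arc_cost_def using W_meas S_meas[OF that] by measurable
  have cost_le: "(\<integral>\<^sup>+\<omega>. ennreal (cost a \<omega>) \<partial>M) \<le> ennreal k" if a: "a \<in> arcs" for a
  proof -
    have "AE \<omega> in M. cost a \<omega> = cs a \<omega> +
      ((face_total \<Gamma> Z (face_pos a) \<omega>)\<^sup>2 + (face_total \<Gamma> Z (face_neg a) \<omega>)\<^sup>2) / cs a \<omega>"
      using W_eq[of "face_pos a"] W_eq[of "face_neg a"] S_eq[OF a]
      by eventually_elim (simp add: cost_def arc_cost_def)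
    then have "(\<integral>\<^sup>+\<omega>. ennreal (cost a \<omega>) \<partial>M) = (\<integral>\<^sup>+\<omega>. ennreal (cs a \<omega> +
      ((face_total \<Gamma> Z (face_pos a) \<omega>)\<^sup>2 + (face_total \<Gamma> Z (face_neg a) \<omega>)\<^sup>2) / cs a \<omega>) \<partial>M)"
      by (intro nn_integral_cong_AE) auto
    also have "\<dots> \<le> ennreal k" unfolding k(2)[symmetric] using a by (rule SUP_upper)
    finally show ?thesis .
  qed
  have S_pos: "AE \<omega> in M. \<forall>a\<in>arcs. 0 < S a \<omega>"
  proof -
    have "AE \<omega> in M. \<forall>a\<in>arcs. cs a \<omega> = S a \<omega>" using S_eq by (simp add: AE_ball_countable[OF arcs])
    with cs_pos show ?thesis by eventually_elim simp
  qed
  \<comment> \<open>The weights 2, 1, 1 are those of the face cost, whence the bound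
    \<open>4 * k\<close> on the expectation.\<close>
  define q where "q x \<omega> = 2 * cost (x, x + (1, 0)) \<omega> + cost (x, x + (0, 1)) \<omega> +
    cost (x + (1, 0), x + (1, 0) + (0, 1)) \<omega>" for x \<omega>
  have in_arcs: "(x, x + (1, 0)) \<in> arcs" "(x, x + (0, 1)) \<in> arcs" for x by (simp_all add: arcs_iff)
  have q_meas [measurable]: "q x \<in> borel_measurable M" for x
    unfolding q_def[abs_def] using cost_meas in_arcs by (intro borel_measurable_add borel_measurable_times) auto
  have cost_nn: "AE \<omega> in M. \<forall>a\<in>arcs. 0 \<le> cost a \<omega>"
    using S_pos by eventually_elim (auto simp: cost_def arc_cost_def less_imp_le)
  have q_nn: "AE \<omega> in M. \<forall>x. 0 \<le> q x \<omega>"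
    using cost_nn by eventually_elim (auto simp: q_def in_arcs)
  have q_le: "(\<integral>\<^sup>+\<omega>. ennreal (q x \<omega>) \<partial>M) \<le> ennreal (4 * k)" for x
  proof -
    let ?a = "(x, x + (1, 0))" and ?b = "(x, x + (0, 1))" and ?c = "(x + (1, 0), x + (1, 0) + (0, 1))"
    have "(\<integral>\<^sup>+\<omega>. ennreal (q x \<omega>) \<partial>M) =
        (\<integral>\<^sup>+\<omega>. 2 * ennreal (cost ?a \<omega>) + ennreal (cost ?b \<omega>) + ennreal (cost ?c \<omega>) \<partial>M)"
    proof (rule nn_integral_cong_AE)
      show "AE \<omega> in M. ennreal (q x \<omega>) =
          2 * ennreal (cost ?a \<omega>) + ennreal (cost ?b \<omega>) + ennreal (cost ?c \<omega>)"
        using cost_nn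
        by eventually_elim (simp add: q_def in_arcs ennreal_plus ennreal_mult)
    qed
    also have "\<dots> = 2 * (\<integral>\<^sup>+\<omega>. ennreal (cost ?a \<omega>) \<partial>M) + (\<integral>\<^sup>+\<omega>. ennreal (cost ?b \<omega>) \<partial>M) +
        (\<integral>\<^sup>+\<omega>. ennreal (cost ?c \<omega>) \<partial>M)"
      using cost_meas[OF in_arcs(1)[of x]] cost_meas[OF in_arcs(2)[of x]] cost_meas[OF in_arcs(2)[of "x + (1, 0)"]]
      by (simp add: nn_integral_add nn_integral_cmult)
    also have "\<dots> \<le> 2 * ennreal k + ennreal k + ennreal k"
      by (intro add_mono mult_left_mono cost_le in_arcs) simp
    also have "\<dots> = (2 + 1 + 1) * ennreal k" by (simp only: distrib_right mult_1_left)
    also have "\<dots> = ennreal (4 * k)" using k(1) by (simp add: ennreal_mult)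
    finally show ?thesis .
  qed

  \<comment> \<open>The exceptional set depends on the starting point, of which there are countably
    many, so one null set serves for all.\<close>
  have "AE \<omega> in M. \<forall>x0. \<forall>\<epsilon>>0. \<exists>R. (\<Sum>x\<in>sup_ball (Suc (Suc R)). (log_slope (Suc R) x)\<^sup>2 * q (x + x0) \<omega>) < \<epsilon>"
    unfolding AE_all_countable
  proof
    fix x0
    show "AE \<omega> in M. \<forall>\<epsilon>>0. \<exists>R. (\<Sum>x\<in>sup_ball (Suc (Suc R)). (log_slope (Suc R) x)\<^sup>2 * q (x + x0) \<omega>) < \<epsilon>"
    proof (rule AE_small_if_nn_integral_tendsto_0)
      show "(\<lambda>\<omega>. \<Sum>x\<in>sup_ball (Suc (Suc R)). (log_slope (Suc R) x)\<^sup>2 * q (x + x0) \<omega>) \<in> borel_measurable M" for R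
        by measurable
      let ?b = "\<lambda>R. 4 * k * (\<Sum>x\<in>sup_ball (Suc (Suc R)). (log_slope (Suc R) x)\<^sup>2)"
      show "?b \<longlonglongrightarrow> 0"
        using tendsto_mult_right_zero[OF LIMSEQ_Suc[OF log_slope_energy_tendsto_0], of "4 * k"] .
      fix R
      have "(\<integral>\<^sup>+\<omega>. ennreal (\<Sum>x\<in>sup_ball (Suc (Suc R)). (log_slope (Suc R) x)\<^sup>2 * q (x + x0) \<omega>) \<partial>M) =
        (\<integral>\<^sup>+\<omega>. (\<Sum>x\<in>sup_ball (Suc (Suc R)). ennreal ((log_slope (Suc R) x)\<^sup>2) * ennreal (q (x + x0) \<omega>)) \<partial>M)"
      proof (rule nn_integral_cong_AE)
        show "AE \<omega> in M. ennreal (\<Sum>x\<in>sup_ball (Suc (Suc R)). (log_slope (Suc R) x)\<^sup>2 * q (x + x0) \<omega>) =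
          (\<Sum>x\<in>sup_ball (Suc (Suc R)). ennreal ((log_slope (Suc R) x)\<^sup>2) * ennreal (q (x + x0) \<omega>))"
          using q_nn
        proof eventually_elim
          case (elim \<omega>)
          then have "0 \<le> q y \<omega>" for y by blast
          then show ?case by (subst sum_ennreal[symmetric]) (simp_all add: ennreal_mult)
        qed
      qed
      also have "\<dots> = (\<Sum>x\<in>sup_ball (Suc (Suc R)).
          ennreal ((log_slope (Suc R) x)\<^sup>2) * (\<integral>\<^sup>+\<omega>. ennreal (q (x + x0) \<omega>) \<partial>M))"
        by (subst nn_integral_sum) (simp_all add: nn_integral_cmult)
      also have "\<dots> \<le> (\<Sum>x\<in>sup_ball (Suc (Suc R)). ennreal ((log_slope (Suc R) x)\<^sup>2) * ennreal (4 * k))"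
        by (intro sum_mono mult_left_mono q_le) simp
      also have "\<dots> = (\<Sum>x\<in>sup_ball (Suc (Suc R)). ennreal (4 * k * (log_slope (Suc R) x)\<^sup>2))"
        using k(1) by (intro sum.cong refl) (simp add: ennreal_mult'' mult.commute)
      also have "\<dots> = ennreal (?b R)"
        using k(1) by (subst sum_ennreal) (simp_all add: sum_distrib_left)
      finally show "(\<integral>\<^sup>+\<omega>. ennreal (\<Sum>x\<in>sup_ball (Suc (Suc R)). (log_slope (Suc R) x)\<^sup>2 * q (x + x0) \<omega>) \<partial>M)
          \<le> ennreal (?b R)" .
    qed
  qed
  moreover have "AE \<omega> in M. \<forall>x. face_cost (\<lambda>a. cs a \<omega>) (\<lambda>x. face_total \<Gamma> Z x \<omega>) x \<le> q x \<omega>"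
  proof -
    have "AE \<omega> in M. \<forall>a\<in>arcs. cs a \<omega> = S a \<omega>" using S_eq by (simp add: AE_ball_countable[OF arcs])
    moreover have "AE \<omega> in M. \<forall>x. face_total \<Gamma> Z x \<omega> = W x \<omega>" using W_eq by (simp add: AE_all_countable)
    ultimately show ?thesis using S_pos
    proof eventually_elim
      case (elim \<omega>)
      show ?case
      proof
        fix x
        have "face_cost (\<lambda>a. cs a \<omega>) (\<lambda>x. face_total \<Gamma> Z x \<omega>) x = face_cost (\<lambda>a. S a \<omega>) (\<lambda>x. W x \<omega>) x"
          using elim(1) elim(2)[rule_format, of x] in_arcs by (simp add: face_cost_def)
        also have "\<dots> \<le> q x \<omega>"
          unfolding q_def cost_def using elim(3) by (intro face_cost_le_arc_cost) blast
        finally show "face_cost (\<lambda>a. cs a \<omega>) (\<lambda>x. face_total \<Gamma> Z x \<omega>) x \<le> q x \<omega>" .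
      qed
    qed
  qed
  ultimately show ?thesis using curl
  proof eventually_elim
    case (elim \<omega>)
    interpret curl_conductances "\<lambda>a. cs a \<omega>" "\<lambda>a. cond_asym \<Gamma> Z a \<omega>" "\<lambda>x. face_total \<Gamma> Z x \<omega>"
      by (rule elim(3))
    show ?case
    proof (rule recurrent_walk_if_small_energy)
      fix x0 :: pt and \<epsilon> :: real assume "0 < \<epsilon>"
      then obtain R where R: "(\<Sum>x\<in>sup_ball (Suc (Suc R)). (log_slope (Suc R) x)\<^sup>2 * q (x + x0) \<omega>) < \<epsilon>"
        using elim(1) by blast
      have "(\<Sum>x\<in>sup_ball (Suc (Suc R)). (log_slope (Suc R) x)\<^sup>2 *
          face_cost (\<lambda>a. cs a \<omega>) (\<lambda>x. face_total \<Gamma> Z x \<omega>) (x + x0)) \<le>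
        (\<Sum>x\<in>sup_ball (Suc (Suc R)). (log_slope (Suc R) x)\<^sup>2 * q (x + x0) \<omega>)"
        by (intro sum_mono mult_left_mono elim(2)[rule_format] zero_le_power2)
      with R show "\<exists>R. (\<Sum>x\<in>sup_ball (Suc (Suc R)). (log_slope (Suc R) x)\<^sup>2 *
          face_cost (\<lambda>a. cs a \<omega>) (\<lambda>x. face_total \<Gamma> Z x \<omega>) (x + x0)) < \<epsilon>"
        by (meson le_less_trans)
    qed
  qed
qed

end
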